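(* Let $(E,\mathcal{P})$ be a random locally convex module over $K$ with base $(\Omega,\mathcal{F},P)$, $x\in E$, and $M\subset E$ a nonempty $\mathcal{T}_c$-closed $L^0$-convex set with the countable concatenation property. If $x\notin M$, then there exist $f\in E^\ast_c$ and $B\in\mathcal{F}$ with $P(B)>0$ such that: (1) $(\mathrm{Re} f)(x)>\bigvee\{(\mathrm{Re} f)(y):y\in M\}$ on $B$; (2) $(\mathrm{Re} f)(x)=\bigvee\{(\mathrm{Re} f)(y):y\in M\}$ on $B^c$.
   Context: $(\Omega,\mathcal{F},P)$ is a probability space and $K$ is $\mathbb{R}$ or $\mathbb{C}$. $L^0(\mathcal{F},K)$ is the algebra of equivalence classes (a.s. equality) of $K$-valued $\mathcal{F}$-measurable random variables, $L^0(\mathcal{F})=L^0(\mathcal{F},\mathbb{R})$; $\bar L^0(\mathcal{F})$ is the set of classes of extended real-valued ones, a complete lattice under the a.s. order, with suprema $\bigvee$ and infima $\bigwedge$ taken in it. $L^0_+(\mathcal{F})=\{\xi\in L^0(\mathcal{F}):\xi\ge0\}$, $L^0_{++}(\mathcal{F})=\{\xi\in L^0(\mathcal{F}):\xi>0\text{ a.s.}\}$; $\tilde I_A$ is the class of the indicator of $A\in\mathcal{F}$. "$\xi>\eta$ on $A$" (similarly $=$) means $\xi(\omega)>\eta(\omega)$ for $P$-almost all $\omega\in A$. A countable partition $\{A_n,n\in\mathbb{N}\}$ of $\Omega$ to $\mathcal{F}$ is a sequence of pairwise disjoint members of $\mathcal{F}$ with union $\Omega$. Random locally convex module over $K$ with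 base $(\Omega,\mathcal{F},P)$: a pair $(E,\mathcal{P})$ with $E$ an $L^0(\mathcal{F},K)$-module and $\mathcal{P}$ a family of $L^0$-seminorms on $E$ (maps $\|\cdot\|:E\to L^0_+(\mathcal{F})$ with $\|\xi x\|=|\xi|\|x\|$ for $\xi\in L^0(\mathcal{F},K)$ and $\|x+y\|\le\|x\|+\|y\|$) such that $\bigvee\{\|x\|:\|\cdot\|\in\mathcal{P}\}=0$ iff $x=\theta$ (null element). $\mathcal{P}_f$ is the family of (nonempty) finite subsets of $\mathcal{P}$, and $\|x\|_{\mathcal{Q}}=\bigvee\{\|x\|:\|\cdot\|\in\mathcal{Q}\}$ for $\mathcal{Q}\in\mathcal{P}_f$. The locally $L^0$-convex topology $\mathcal{T}_c$ on $E$ has local base at $\theta$: $\{x:\|x\|_{\mathcal{Q}}\le\varepsilon\}$, $\mathcal{Q}\in\mathcal{P}_f$, $\varepsilon\in L^0_{++}(\mathcal{F})$; $L^0(\mathcal{F},K)$ carries its own $\mathcal{T}_c$ determined by $|\cdot|$. $E^\ast_c$ is the $L^0(\mathcal{F},K)$-module of continuous module homomorphisms from $(E,\mathcal{T}_c)$ to $(L^0(\mathcal{F},K),\mathcal{T}_c)$. $(\mathrm{Re} f)(x)$ is the real part of $f(x)$. $M\subset E$ is $L^0$-convex if $\xi x+(1-\xi)y\in M$ for all $x,y\in M$ and $\xi\in L^0_+(\mathcal{F})$ with $0\le\xi\le1$. $M$ has the countable concatenation property if for each sequence $\{x_n\}$ in $M$ and each countable partition $\{A_n\}$ of $\Omega$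 to $\mathcal{F}$ there is $x\in M$ with $\tilde I_{A_n}x=\tilde I_{A_n}x_n$ for all $n$ (such an $x$ is unique in $E$). *)

theory Defs
  imports "HOL-Probability.Probability" "HOL-Algebra.Module"
begin

section \<open>Classes of random variables modulo almost sure equality\<close>

text \<open>The scalar field \<open>K\<close> is a set of complex numbers, either \<open>\<real>\<close> or \<open>UNIV\<close>; thus \<open>L0 P K\<close> is
  \<open>L\<^sup>0(\<F>,K)\<close>. Real-valued classes, \<open>L0 P (UNIV :: real set)\<close>, and extended real-valued classes,
  \<open>L0 P (UNIV :: ereal set)\<close>, are kept as separate types and related by explicit embeddings.\<close>

definition rv :: "'w measure \<Rightarrow> 'v::topological_space set \<Rightarrow> ('w \<Rightarrow> 'v) set" where
  "rv P V = P \<rightarrow>\<^sub>M restrict_space borel V"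

definition ae_eq :: "'w measure \<Rightarrow> 'v::topological_space set \<Rightarrow> (('w \<Rightarrow> 'v) \<times> ('w \<Rightarrow> 'v)) set" where
  "ae_eq P V = {(f, g). f \<in> rv P V \<and> g \<in> rv P V \<and> (AE \<omega> in P. f \<omega> = g \<omega>)}"

definition L0 :: "'w measure \<Rightarrow> 'v::topological_space set \<Rightarrow> ('w \<Rightarrow> 'v) set set" where
  "L0 P V = rv P V // ae_eq P V"

definition L0_class :: "'w measure \<Rightarrow> 'v::topological_space set \<Rightarrow> ('w \<Rightarrow> 'v) \<Rightarrow> ('w \<Rightarrow> 'v) set" where
  "L0_class P V f = ae_eq P V `` {f}"

text \<open>All notions below apply a pointwise operation or an almost sure relation to representatives,
  so they do not depend on the representative chosen here.\<close>

definition rep :: "('w \<Rightarrow> 'v) set \<Rightarrow> 'w \<Rightarrow> 'v" where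
  "rep X = (SOME f. f \<in> X)"

definition L0_le :: "'w measure \<Rightarrow> ('w \<Rightarrow> 'v::ord) set \<Rightarrow> ('w \<Rightarrow> 'v) set \<Rightarrow> bool" where
  "L0_le P X Y \<longleftrightarrow> (AE \<omega> in P. rep X \<omega> \<le> rep Y \<omega>)"

text \<open>\<open>L\<^sup>0(\<F>,K)\<close> as an algebra over itself: \<open>smult\<close> is the ring multiplication.\<close>

definition L0_alg :: "'w measure \<Rightarrow> complex set \<Rightarrow>
    (('w \<Rightarrow> complex) set, ('w \<Rightarrow> complex) set) module" where
  "L0_alg P K =
    \<lparr> carrier = L0 P K,
      mult = (\<lambda>X Y. L0_class P K (\<lambda>\<omega>. rep X \<omega> * rep Y \<omega>)),
      one = L0_class P K (\<lambda>\<omega>. 1),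
      zero = L0_class P K (\<lambda>\<omega>. 0),
      add = (\<lambda>X Y. L0_class P K (\<lambda>\<omega>. rep X \<omega> + rep Y \<omega>)),
      smult = (\<lambda>X Y. L0_class P K (\<lambda>\<omega>. rep X \<omega> * rep Y \<omega>)) \<rparr>"

definition L0_indicator :: "'w measure \<Rightarrow> complex set \<Rightarrow> 'w set \<Rightarrow> ('w \<Rightarrow> complex) set" where
  "L0_indicator P K A = L0_class P K (indicator A)"

definition L0_plus :: "'w measure \<Rightarrow> ('w \<Rightarrow> real) set \<Rightarrow> ('w \<Rightarrow> real) set \<Rightarrow> ('w \<Rightarrow> real) set" where
  "L0_plus P X Y = L0_class P UNIV (\<lambda>\<omega>. rep X \<omega> + rep Y \<omega>)"

definition L0_times :: "'w measure \<Rightarrow> ('w \<Rightarrow> real) set \<Rightarrow> ('w \<Rightarrow> real) set \<Rightarrow> ('w \<Rightarrow> real) set" where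
  "L0_times P X Y = L0_class P UNIV (\<lambda>\<omega>. rep X \<omega> * rep Y \<omega>)"

definition L0_abs :: "'w measure \<Rightarrow> ('w \<Rightarrow> complex) set \<Rightarrow> ('w \<Rightarrow> real) set" where
  "L0_abs P X = L0_class P UNIV (\<lambda>\<omega>. cmod (rep X \<omega>))"

definition L0_Re :: "'w measure \<Rightarrow> ('w \<Rightarrow> complex) set \<Rightarrow> ('w \<Rightarrow> real) set" where
  "L0_Re P X = L0_class P UNIV (\<lambda>\<omega>. Re (rep X \<omega>))"

definition L0_scalar :: "'w measure \<Rightarrow> complex set \<Rightarrow> ('w \<Rightarrow> real) set \<Rightarrow> ('w \<Rightarrow> complex) set" where
  "L0_scalar P K X = L0_class P K (\<lambda>\<omega>. complex_of_real (rep X \<omega>))"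

definition L0_ext :: "'w measure \<Rightarrow> ('w \<Rightarrow> real) set \<Rightarrow> ('w \<Rightarrow> ereal) set" where
  "L0_ext P X = L0_class P UNIV (\<lambda>\<omega>. ereal (rep X \<omega>))"

definition L0_nonneg :: "'w measure \<Rightarrow> ('w \<Rightarrow> real) set set" where
  "L0_nonneg P = {X \<in> L0 P UNIV. AE \<omega> in P. 0 \<le> rep X \<omega>}"

definition L0_pos :: "'w measure \<Rightarrow> ('w \<Rightarrow> real) set set" where
  "L0_pos P = {X \<in> L0 P UNIV. AE \<omega> in P. 0 < rep X \<omega>}"

text \<open>Suprema \<open>\<Squnion>\<^bsub>L0_bar P\<^esub> S\<close> are taken in the lattice of extended real-valued classes; in particular the
  supremum of the empty set is the class of \<open>-\<infinity>\<close>.\<close>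

definition L0_bar :: "'w measure \<Rightarrow> ('w \<Rightarrow> ereal) set gorder" where
  "L0_bar P = \<lparr> carrier = L0 P UNIV, eq = (=), le = L0_le P \<rparr>"

lemma equiv_ae_eq: "equiv (rv P V) (ae_eq P V)"
proof (rule equivI)
  show "ae_eq P V \<subseteq> rv P V \<times> rv P V" by (auto simp: ae_eq_def)
  show "refl_on (rv P V) (ae_eq P V)" by (auto simp: refl_on_def ae_eq_def)
  show "sym (ae_eq P V)" by (auto simp: sym_def ae_eq_def eq_commute)
  show "trans (ae_eq P V)"
    unfolding trans_def ae_eq_def by (auto elim!: AE_mp)
qed

lemma L0_class_in: "f \<in> rv P V \<Longrightarrow> L0_class P V f \<in> L0 P V"
  by (auto simp: L0_class_def L0_def quotientI)

lemma rep_in: assumes "X \<in> L0 P V" shows "rep X \<in> X"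
  using assms equiv_Eps_in[OF equiv_ae_eq, of X P V] by (simp add: rep_def L0_def)

lemma rep_rv: "X \<in> L0 P V \<Longrightarrow> rep X \<in> rv P V"
  using rep_in in_quotient_imp_subset[OF equiv_ae_eq] unfolding L0_def by blast

lemma class_rep: assumes "X \<in> L0 P V" shows "L0_class P V (rep X) = X"
proof -
  obtain f where f: "X = ae_eq P V `` {f}" using assms unfolding L0_def by (rule quotientE)
  have "(f, rep X) \<in> ae_eq P V" using rep_in[OF assms] unfolding f by simp
  from equiv_class_eq[OF equiv_ae_eq this] show ?thesis by (simp add: L0_class_def f)
qed

lemma rep_class: assumes "f \<in> rv P V" shows "AE w in P. rep (L0_class P V f) w = f w"
proof -
  have "rep (L0_class P V f) \<in> L0_class P V f" using rep_in L0_class_in assms by blast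
  then show ?thesis unfolding L0_class_def ae_eq_def by (auto simp: eq_commute)
qed

lemma class_eq: "f \<in> rv P V \<Longrightarrow> g \<in> rv P V \<Longrightarrow> AE w in P. f w = g w \<Longrightarrow> L0_class P V f = L0_class P V g"
  unfolding L0_class_def by (rule equiv_class_eq[OF equiv_ae_eq]) (auto simp: ae_eq_def)

lemma L0_eqI: assumes "X \<in> L0 P V" "Y \<in> L0 P V" "AE w in P. rep X w = rep Y w" shows "X = Y"
  using class_eq[OF rep_rv[OF assms(1)] rep_rv[OF assms(2)] assms(3)]
  unfolding class_rep[OF assms(1)] class_rep[OF assms(2)] .

lemma rv_iff: "f \<in> rv P V \<longleftrightarrow> f \<in> borel_measurable P \<and> (\<forall>w\<in>space P. f w \<in> V)"
  unfolding rv_def by (auto simp: measurable_restrict_space2_iff)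

lemma rv_UNIV[simp]: "rv P UNIV = borel_measurable P"
  by (auto simp: rv_iff)

lemma partial_order_L0_bar: "partial_order (L0_bar P)"
proof (unfold_locales)
  fix x y assume "x \<sqsubseteq>\<^bsub>L0_bar P\<^esub> y" "y \<sqsubseteq>\<^bsub>L0_bar P\<^esub> x" "x \<in> carrier (L0_bar P)" "y \<in> carrier (L0_bar P)"
  then show "x .=\<^bsub>L0_bar P\<^esub> y"
  proof -
    from \<open>x \<sqsubseteq>\<^bsub>L0_bar P\<^esub> y\<close> \<open>y \<sqsubseteq>\<^bsub>L0_bar P\<^esub> x\<close> have "AE w in P. rep x w = rep y w"
      by (auto simp: L0_bar_def L0_le_def elim!: AE_mp)
    with \<open>x \<in> carrier (L0_bar P)\<close> \<open>y \<in> carrier (L0_bar P)\<close> have "x = y"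
      by (intro L0_eqI) (auto simp: L0_bar_def)
    then show ?thesis by (simp add: L0_bar_def)
  qed
next
  fix x y z assume "x \<sqsubseteq>\<^bsub>L0_bar P\<^esub> y" "y \<sqsubseteq>\<^bsub>L0_bar P\<^esub> z"
  then show "x \<sqsubseteq>\<^bsub>L0_bar P\<^esub> z" by (auto simp: L0_bar_def L0_le_def elim!: AE_mp)
qed (auto simp: L0_bar_def L0_le_def)

lemma upper_semilattice_L0_bar: "upper_semilattice (L0_bar P)"
proof -
  interpret partial_order "L0_bar P" by (rule partial_order_L0_bar)
  show ?thesis
  proof (unfold_locales)
    fix x y assume xy: "x \<in> carrier (L0_bar P)" "y \<in> carrier (L0_bar P)"
    then have X: "x \<in> L0 P UNIV" "y \<in> L0 P UNIV" by (auto simp: L0_bar_def)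
    let ?m = "\<lambda>w. max (rep x w) (rep y w)"
    have m: "?m \<in> rv P UNIV" using rep_rv[OF X(1)] rep_rv[OF X(2)] by simp
    have "least (L0_bar P) (L0_class P UNIV ?m) (Upper (L0_bar P) {x, y})"
    proof -
      let ?c = "L0_class P UNIV ?m"
      note r = rep_class[OF m]
      have 1: "L0_le P x ?c" using r unfolding L0_le_def by eventually_elim simp
      have 2: "L0_le P y ?c" using r unfolding L0_le_def by eventually_elim simp
      have 3: "L0_le P ?c z" if "L0_le P x z" "L0_le P y z" for z
        using r that unfolding L0_le_def by eventually_elim simp
      show ?thesis using 1 2 3 L0_class_in[OF m] X
        unfolding least_def Upper_def by (simp add: L0_bar_def)
    qed
    then show "\<exists>s. least (L0_bar P) s (Upper (L0_bar P) {x, y})" ..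
  qed
qed


section \<open>Random locally convex modules\<close>

definition L0_seminorm :: "'w measure \<Rightarrow> complex set \<Rightarrow> (('w \<Rightarrow> complex) set, 'e, 'm) module_scheme \<Rightarrow>
    ('e \<Rightarrow> ('w \<Rightarrow> real) set) \<Rightarrow> bool" where
  "L0_seminorm P K E p \<longleftrightarrow>
    p \<in> carrier E \<rightarrow> L0_nonneg P \<and>
    (\<forall>\<xi>\<in>L0 P K. \<forall>x\<in>carrier E. p (\<xi> \<odot>\<^bsub>E\<^esub> x) = L0_times P (L0_abs P \<xi>) (p x)) \<and>
    (\<forall>x\<in>carrier E. \<forall>y\<in>carrier E. L0_le P (p (x \<oplus>\<^bsub>E\<^esub> y)) (L0_plus P (p x) (p y)))"

definition sup_seminorm :: "'w measure \<Rightarrow> ('e \<Rightarrow> ('w \<Rightarrow> real) set) set \<Rightarrow> 'e \<Rightarrow> ('w \<Rightarrow> ereal) set" where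
  "sup_seminorm P \<Q> x = \<Squnion>\<^bsub>L0_bar P\<^esub> ((\<lambda>p. L0_ext P (p x)) ` \<Q>)"

locale random_locally_convex_module =
  prob_space P + Module.module "L0_alg P K" E
  for P :: "'w measure"
    and K :: "complex set"
    and E :: "(('w \<Rightarrow> complex) set, 'e, 'm) module_scheme" (structure) +
  fixes \<P> :: "('e \<Rightarrow> ('w \<Rightarrow> real) set) set"
  assumes scalar_field: "K = \<real> \<or> K = UNIV"
    and seminorms: "p \<in> \<P> \<Longrightarrow> L0_seminorm P K E p"
    and separated: "x \<in> carrier E \<Longrightarrow> sup_seminorm P \<P> x = L0_class P UNIV (\<lambda>\<omega>. 0) \<longleftrightarrow> x = \<zero>"

definition Tc_nbhd :: "'w measure \<Rightarrow> (('w \<Rightarrow> complex) set, 'e, 'm) module_scheme \<Rightarrow>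
    ('e \<Rightarrow> ('w \<Rightarrow> real) set) set \<Rightarrow> ('w \<Rightarrow> real) set \<Rightarrow> 'e \<Rightarrow> 'e set" where
  "Tc_nbhd P E \<Q> \<epsilon> x = {y \<in> carrier E. L0_le P (sup_seminorm P \<Q> (y \<ominus>\<^bsub>E\<^esub> x)) (L0_ext P \<epsilon>)}"

text \<open>The translation-invariant topology whose neighbourhood base at zero consists of the sets
  \<open>Tc_nbhd P E \<Q> \<epsilon> \<zero>\<close> for nonempty finite \<open>\<Q> \<subseteq> \<P>\<close> and \<open>\<epsilon> \<in> L0_pos P\<close>.\<close>

definition Tc :: "'w measure \<Rightarrow> (('w \<Rightarrow> complex) set, 'e, 'm) module_scheme \<Rightarrow>
    ('e \<Rightarrow> ('w \<Rightarrow> real) set) set \<Rightarrow> 'e topology" where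
  "Tc P E \<P> = topology (\<lambda>U. U \<subseteq> carrier E \<and>
    (\<forall>x\<in>U. \<exists>\<Q> \<epsilon>. \<Q> \<subseteq> \<P> \<and> finite \<Q> \<and> \<Q> \<noteq> {} \<and> \<epsilon> \<in> L0_pos P \<and> Tc_nbhd P E \<Q> \<epsilon> x \<subseteq> U))"

lemma istopology_Tc:
  assumes "random_locally_convex_module P K E \<P>"
  shows "istopology (\<lambda>U. U \<subseteq> carrier E \<and>
    (\<forall>x\<in>U. \<exists>\<Q> \<epsilon>. \<Q> \<subseteq> \<P> \<and> finite \<Q> \<and> \<Q> \<noteq> {} \<and> \<epsilon> \<in> L0_pos P \<and> Tc_nbhd P E \<Q> \<epsilon> x \<subseteq> U))"
  (is "istopology ?T")
proof -
  interpret random_locally_convex_module P K E \<P> by fact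
  interpret L: upper_semilattice "L0_bar P" by (rule upper_semilattice_L0_bar)
  have ext: "L0_ext P X \<in> carrier (L0_bar P)" if "X \<in> L0 P UNIV" for X
    using rep_rv[OF that] by (auto simp: L0_bar_def L0_ext_def intro!: L0_class_in)
  have pc: "L0_ext P (p x) \<in> carrier (L0_bar P)" if "p \<in> \<P>" "x \<in> carrier E" for p x
    using seminorms[OF that(1)] that(2) by (auto simp: L0_seminorm_def L0_nonneg_def intro!: ext)
  have mono: "L0_le P (sup_seminorm P A x) (sup_seminorm P B x)"
    if "A \<subseteq> B" "A \<noteq> {}" "finite B" "B \<subseteq> \<P>" "x \<in> carrier E" for A B x
  proof -
    have "least (L0_bar P) (sup_seminorm P S x) (Upper (L0_bar P) ((\<lambda>p. L0_ext P (p x)) ` S))"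
      if "S \<subseteq> B" "S \<noteq> {}" for S
      unfolding sup_seminorm_def
      apply (rule L.finite_sup_least)
      apply (rule finite_imageI[OF finite_subset[OF that(1) \<open>finite B\<close>]])
      using that \<open>finite B\<close> \<open>B \<subseteq> \<P>\<close> pc \<open>x \<in> carrier E\<close> by (auto intro: finite_subset finite_imageI)
    from this[of A] this[of B] that
    have 1: "least (L0_bar P) (sup_seminorm P A x) (Upper (L0_bar P) ((\<lambda>p. L0_ext P (p x)) ` A))"
     and 2: "least (L0_bar P) (sup_seminorm P B x) (Upper (L0_bar P) ((\<lambda>p. L0_ext P (p x)) ` B))" by auto
    have "sup_seminorm P B x \<in> Upper (L0_bar P) ((\<lambda>p. L0_ext P (p x)) ` A)"
      using 2 that(1) unfolding least_def Upper_def by fastforce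
    then show ?thesis using 1 unfolding least_def by (auto simp: L0_bar_def)
  qed
  have inter: "?T (U \<inter> V)" if U: "?T U" and V: "?T V" for U V
  proof (intro conjI ballI)
    show "U \<inter> V \<subseteq> carrier E" using U by auto
    fix x assume x: "x \<in> U \<inter> V"
    obtain A a where A: "A \<subseteq> \<P>" "finite A" "A \<noteq> {}" "a \<in> L0_pos P" "Tc_nbhd P E A a x \<subseteq> U"
      using U x by blast
    obtain B b where B: "B \<subseteq> \<P>" "finite B" "B \<noteq> {}" "b \<in> L0_pos P" "Tc_nbhd P E B b x \<subseteq> V"
      using V x by blast
    let ?m = "\<lambda>w. min (rep a w) (rep b w)"
    have ab: "a \<in> L0 P UNIV" "b \<in> L0 P UNIV" using A B by (auto simp: L0_pos_def)
    have m: "?m \<in> rv P UNIV" using rep_rv[OF ab(1)] rep_rv[OF ab(2)] by simp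
    let ?e = "L0_class P UNIV ?m"
    have e: "?e \<in> L0 P UNIV" by (rule L0_class_in[OF m])
    have epos: "?e \<in> L0_pos P"
      using e rep_class[OF m] A(4) B(4) by (auto simp: L0_pos_def elim!: AE_mp)
    have exle: "L0_le P (L0_ext P c) (L0_ext P d)" if "c \<in> L0 P UNIV" "d \<in> L0 P UNIV" "L0_le P c d" for c d :: "('a \<Rightarrow> real) set"
    proof -
      have r: "(\<lambda>w. ereal (rep c w)) \<in> rv P UNIV" "(\<lambda>w. ereal (rep d w)) \<in> rv P UNIV"
        using rep_rv[OF that(1)] rep_rv[OF that(2)] by auto
      show ?thesis using rep_class[OF r(1)] rep_class[OF r(2)] that(3)
        by (auto simp: L0_le_def L0_ext_def elim!: AE_mp)
    qed
    have "L0_le P ?e a" "L0_le P ?e b"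
      using rep_class[OF m] by (auto simp: L0_le_def elim!: AE_mp)
    note E = exle[OF e ab(1) this(1)] exle[OF e ab(2) this(2)]
    have tr: "L0_le P X Y \<Longrightarrow> L0_le P Y Z \<Longrightarrow> L0_le P X Z" for X Y Z :: "('a \<Rightarrow> ereal) set"
      by (auto simp: L0_le_def elim!: AE_mp)
    have xc: "x \<in> carrier E" using U x by auto
    have "Tc_nbhd P E (A \<union> B) ?e x \<subseteq> U \<inter> V"
    proof
      fix y assume y: "y \<in> Tc_nbhd P E (A \<union> B) ?e x"
      then have yc: "y \<in> carrier E" by (auto simp: Tc_nbhd_def)
      have "y \<ominus>\<^bsub>E\<^esub> x \<in> carrier E" using yc xc by simp
      then have "L0_le P (sup_seminorm P A (y \<ominus>\<^bsub>E\<^esub> x)) (sup_seminorm P (A \<union> B) (y \<ominus>\<^bsub>E\<^esub> x))"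
         "L0_le P (sup_seminorm P B (y \<ominus>\<^bsub>E\<^esub> x)) (sup_seminorm P (A \<union> B) (y \<ominus>\<^bsub>E\<^esub> x))"
        using mono A B by auto
      then have "y \<in> Tc_nbhd P E A a x" "y \<in> Tc_nbhd P E B b x"
        using y yc E by (auto simp: Tc_nbhd_def intro: tr)
      then show "y \<in> U \<inter> V" using A B by auto
    qed
    then show "\<exists>\<Q> \<epsilon>. \<Q> \<subseteq> \<P> \<and> finite \<Q> \<and> \<Q> \<noteq> {} \<and> \<epsilon> \<in> L0_pos P \<and> Tc_nbhd P E \<Q> \<epsilon> x \<subseteq> U \<inter> V"
      using A B epos by (intro exI[of _ "A \<union> B"] exI[of _ ?e]) auto
  qed
  have union: "?T (\<Union>\<K>)" if "\<And>U. U \<in> \<K> \<Longrightarrow> ?T U" for \<K>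
  proof (intro conjI ballI)
    show "\<Union>\<K> \<subseteq> carrier E" using that by auto
    fix x assume "x \<in> \<Union>\<K>"
    then obtain U where U: "U \<in> \<K>" "x \<in> U" by auto
    with that[OF U(1)] obtain \<Q> \<epsilon> where "\<Q> \<subseteq> \<P>" "finite \<Q>" "\<Q> \<noteq> {}" "\<epsilon> \<in> L0_pos P" "Tc_nbhd P E \<Q> \<epsilon> x \<subseteq> U" by meson
    moreover have "U \<subseteq> \<Union>\<K>" using U by auto
    ultimately show "\<exists>\<Q> \<epsilon>. \<Q> \<subseteq> \<P> \<and> finite \<Q> \<and> \<Q> \<noteq> {} \<and> \<epsilon> \<in> L0_pos P \<and> Tc_nbhd P E \<Q> \<epsilon> x \<subseteq> \<Union>\<K>" by (meson subset_trans)
  qed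
  show ?thesis unfolding istopology_def
  proof (intro conjI[of "\<forall>S T. ?T S \<longrightarrow> ?T T \<longrightarrow> ?T (S \<inter> T)"] allI impI)
    show "?T (S \<inter> T)" if "?T S" "?T T" for S T by (rule inter[OF that])
    show "?T (\<Union>\<K>)" if "\<forall>K\<in>\<K>. ?T K" for \<K> by (rule union) (rule bspec[OF that])
  qed
qed

corollary openin_Tc:
  assumes "random_locally_convex_module P K E \<P>"
  shows "openin (Tc P E \<P>) U \<longleftrightarrow> U \<subseteq> carrier E \<and>
    (\<forall>x\<in>U. \<exists>\<Q> \<epsilon>. \<Q> \<subseteq> \<P> \<and> finite \<Q> \<and> \<Q> \<noteq> {} \<and> \<epsilon> \<in> L0_pos P \<and> Tc_nbhd P E \<Q> \<epsilon> x \<subseteq> U)"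
  by (simp only: Tc_def topology_inverse'[OF istopology_Tc[OF assms]])

definition dual_c :: "'w measure \<Rightarrow> complex set \<Rightarrow> (('w \<Rightarrow> complex) set, 'e, 'm) module_scheme \<Rightarrow>
    ('e \<Rightarrow> ('w \<Rightarrow> real) set) set \<Rightarrow> ('e \<Rightarrow> ('w \<Rightarrow> complex) set) set" where
  "dual_c P K E \<P> = {f \<in> carrier E \<rightarrow> L0 P K.
    (\<forall>x\<in>carrier E. \<forall>y\<in>carrier E. f (x \<oplus>\<^bsub>E\<^esub> y) = f x \<oplus>\<^bsub>L0_alg P K\<^esub> f y) \<and>
    (\<forall>\<xi>\<in>L0 P K. \<forall>x\<in>carrier E. f (\<xi> \<odot>\<^bsub>E\<^esub> x) = \<xi> \<otimes>\<^bsub>L0_alg P K\<^esub> f x) \<and>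
    continuous_map (Tc P E \<P>) (Tc P (L0_alg P K) {L0_abs P}) f}"

definition L0_convex :: "'w measure \<Rightarrow> complex set \<Rightarrow> (('w \<Rightarrow> complex) set, 'e, 'm) module_scheme \<Rightarrow>
    'e set \<Rightarrow> bool" where
  "L0_convex P K E M \<longleftrightarrow>
    (\<forall>x\<in>M. \<forall>y\<in>M. \<forall>\<xi>\<in>L0_nonneg P. L0_le P \<xi> (L0_class P UNIV (\<lambda>\<omega>. 1)) \<longrightarrow>
      (L0_scalar P K \<xi> \<odot>\<^bsub>E\<^esub> x) \<oplus>\<^bsub>E\<^esub>
      ((\<one>\<^bsub>L0_alg P K\<^esub> \<ominus>\<^bsub>L0_alg P K\<^esub> L0_scalar P K \<xi>) \<odot>\<^bsub>E\<^esub> y) \<in> M)"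

definition countable_concatenation :: "'w measure \<Rightarrow> complex set \<Rightarrow>
    (('w \<Rightarrow> complex) set, 'e, 'm) module_scheme \<Rightarrow> 'e set \<Rightarrow> bool" where
  "countable_concatenation P K E M \<longleftrightarrow>
    (\<forall>(u :: nat \<Rightarrow> 'e) (A :: nat \<Rightarrow> 'w set).
      range u \<subseteq> M \<and> range A \<subseteq> sets P \<and> disjoint_family A \<and> (\<Union>n. A n) = space P \<longrightarrow>
      (\<exists>x\<in>M. \<forall>n. L0_indicator P K (A n) \<odot>\<^bsub>E\<^esub> x = L0_indicator P K (A n) \<odot>\<^bsub>E\<^esub> u n))"

definition sup_Re :: "'w measure \<Rightarrow> ('e \<Rightarrow> ('w \<Rightarrow> complex) set) \<Rightarrow> 'e set \<Rightarrow> ('w \<Rightarrow> ereal) set" where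
  "sup_Re P f M = \<Squnion>\<^bsub>L0_bar P\<^esub> ((\<lambda>y. L0_ext P (L0_Re P (f y))) ` M)"

definition less_on :: "'w measure \<Rightarrow> 'w set \<Rightarrow> ('w \<Rightarrow> 'v::ord) set \<Rightarrow> ('w \<Rightarrow> 'v) set \<Rightarrow> bool" where
  "less_on P B X Y \<longleftrightarrow> (AE \<omega> in P. \<omega> \<in> B \<longrightarrow> rep X \<omega> < rep Y \<omega>)"

definition eq_on :: "'w measure \<Rightarrow> 'w set \<Rightarrow> ('w \<Rightarrow> 'v) set \<Rightarrow> ('w \<Rightarrow> 'v) set \<Rightarrow> bool" where
  "eq_on P B X Y \<longleftrightarrow> (AE \<omega> in P. \<omega> \<in> B \<longrightarrow> rep X \<omega> = rep Y \<omega>)"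

end

theory Submission
  imports Defs
begin

text \<open>A family of random variables has an essential supremum, attained by a countable subfamily.
  Since \<open>M\<close> is closed, some neighbourhood \<open>{y. \<parallel>y - x\<parallel>\<^sub>\<Q> \<le> \<epsilon>}\<close> of \<open>x\<close> avoids \<open>M\<close>, and countable
  concatenation upgrades this to an event \<open>B\<close> of positive probability on which every \<open>y \<in> M\<close>
  is at distance at least \<open>\<epsilon>\<close> from \<open>x\<close>. A Hahn--Banach argument with the \<open>L\<^sup>0\<close>-seminorm
  \<open>N = 1\<^sub>B \<Sum>{p | p \<in> \<Q>}\<close> then gives a real homomorphism \<open>F \<le> N\<close> with \<open>F (x - y) \<ge> 1\<^sub>B \<epsilon>\<close> for all \<open>y \<in> M\<close>;
  it vanishes off \<open>B\<close>, which yields (2), and it is the real part of an element of the dual.\<close>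

section \<open>Essential suprema of families of random variables\<close>

text \<open>The usual one-step Hahn-Banach extension meets an obstacle, because L0 is not a field: a
  submodule and a new vector \<open>z\<close> may be tied by relations \<open>t z = m\<close> in
  which \<open>t\<close> vanishes on part of the space, and division by \<open>t\<close> is possible
  only on the rest. So no partial homomorphism is ever extended. Instead lower bounds
  \<open>s \<le> F c\<close> are collected, with \<open>c\<close> ranging over all of
  \<open>E\<close> from the start; the bounds \<open>- N e \<le> F e\<close> are always among them,
  and consistency only means \<open>s \<le> N c\<close>. Lower bounds survive addition and
  multiplication by nonnegative scalars, so the collection is a cone, and Zorn's lemma applies to
  plain inclusion. The separation inequality is put into the initial cone; this replaces a Minkowski
  functional and a starting homomorphism on a submodule. The second obstacle is that a vector may
  carry uncountably many lower bounds. Their pointwise supremum need not be measurable and ignores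
  null sets, so the best bound has to be an essential supremum, and each law for it holds only
  outside a null set that depends on the vectors and scalars involved.\<close>

lemma (in finite_measure) countable_essential_union:
  assumes "\<A> \<subseteq> sets M"
  obtains \<B> where "\<B> \<subseteq> \<A>" "countable \<B>" "\<And>A. A \<in> \<A> \<Longrightarrow> AE \<omega> in M. \<omega> \<in> A \<longrightarrow> \<omega> \<in> \<Union>\<B>"
proof -
  \<comment> \<open>Exhaustion: the union of a maximising sequence of countable subfamilies is again
    countable, and it attains \<open>Sup V\<close>.\<close>
  define V where "V = {measure M (\<Union>\<B>) |\<B>. \<B> \<subseteq> \<A> \<and> countable \<B>}"
  have ne: "V \<noteq> {}" unfolding V_def by (auto intro!: exI[of _ "{}"])
  have bdd: "bdd_above V" unfolding V_def
    by (rule bdd_aboveI[of _ "measure M (space M)"]) (auto intro: bounded_measure)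
  have "\<exists>\<B>. \<B> \<subseteq> \<A> \<and> countable \<B> \<and> Sup V - 1 / real (Suc n) < measure M (\<Union>\<B>)" for n
  proof -
    have "Sup V - 1 / real (Suc n) < Sup V" by simp
    then obtain v where "v \<in> V" "Sup V - 1 / real (Suc n) < v"
      using less_cSup_iff[OF ne bdd] by blast
    then show ?thesis unfolding V_def by auto
  qed
  then obtain \<C> where \<C>: "\<And>n. \<C> n \<subseteq> \<A>" "\<And>n. countable (\<C> n)"
    "\<And>n. Sup V - 1 / real (Suc n) < measure M (\<Union>(\<C> n))" by metis
  define \<B> where "\<B> = (\<Union>n. \<C> n)"
  have \<B>: "\<B> \<subseteq> \<A>" "countable \<B>" using \<C> by (auto simp: \<B>_def)
  have U: "\<Union>\<B> \<in> sets M" using \<B> assms by (intro sets.countable_Union) auto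
  have "Sup V \<le> measure M (\<Union>\<B>)"
  proof (rule field_le_epsilon)
    fix e :: real assume "0 < e"
    then obtain n where n: "1 / real (Suc n) < e"
      using reals_Archimedean by (auto simp: inverse_eq_divide)
    have "measure M (\<Union>(\<C> n)) \<le> measure M (\<Union>\<B>)"
      using U by (intro finite_measure_mono) (auto simp: \<B>_def)
    then show "Sup V \<le> measure M (\<Union>\<B>) + e" using \<C>(3)[of n] n by linarith
  qed
  then have null: "measure M (A - \<Union>\<B>) = 0" if "A \<in> \<A>" for A
  proof -
    have A: "A \<in> sets M" using that assms by auto
    \<comment> \<open>One more member keeps the family countable, so it cannot push the measure
      beyond the maximum already attained; what \<open>A\<close> adds is null.\<close>
    have "measure M (\<Union>(insert A \<B>)) \<in> V" unfolding V_def using \<B> that by blast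
    then have "measure M (A \<union> \<Union>\<B>) \<le> Sup V" using bdd by (auto intro: cSup_upper)
    moreover have "measure M (\<Union>\<B> \<union> (A - \<Union>\<B>)) = measure M (\<Union>\<B>) + measure M (A - \<Union>\<B>)"
      using A U by (intro finite_measure_Union) auto
    ultimately show ?thesis
      using \<open>Sup V \<le> measure M (\<Union>\<B>)\<close> measure_nonneg[of M "A - \<Union>\<B>"] by (simp add: Un_commute order_antisym)
  qed
  have "AE \<omega> in M. \<omega> \<in> A \<longrightarrow> \<omega> \<in> \<Union>\<B>" if "A \<in> \<A>" for A
  proof (rule AE_I[where N = "A - \<Union>\<B>"])
    show "emeasure M (A - \<Union>\<B>) = 0" using null[OF that] by (simp add: emeasure_eq_measure)
    show "A - \<Union>\<B> \<in> sets M" using that assms U by auto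
  qed auto
  then show thesis using that \<B> by blast
qed

text \<open>Exhaustion is applied to the superlevel sets at each rational level, and the subfamilies
  found are united over the countably many levels. If \<open>s\<close> exceeded the supremum of the
  union at a point, some rational level would be passed there by \<open>s\<close> and by no chosen
  function, which happens only on a null set.\<close>

lemma (in finite_measure) countable_essential_supremum:
  fixes S :: "('a \<Rightarrow> ereal) set"
  assumes "S \<subseteq> borel_measurable M"
  obtains T where "T \<subseteq> S" "countable T" "\<And>s. s \<in> S \<Longrightarrow> AE \<omega> in M. s \<omega> \<le> (SUP t\<in>T. t \<omega>)"
proof -
  define D where "D = (\<lambda>(q::rat) s. {\<omega>\<in>space M. ereal (of_rat q) < s \<omega>})"
  have *: "\<exists>\<B>. \<B> \<subseteq> D q ` S \<and> countable \<B> \<and> (\<forall>A\<in>D q ` S. AE \<omega> in M. \<omega> \<in> A \<longrightarrow> \<omega> \<in> \<Union>\<B>)" for q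
  proof -
    have "D q ` S \<subseteq> sets M" using assms by (auto simp: D_def)
    from countable_essential_union[OF this] show ?thesis by metis
  qed
  have "\<exists>T. T \<subseteq> S \<and> countable T \<and> (\<forall>s\<in>S. AE \<omega> in M. \<omega> \<in> D q s \<longrightarrow> \<omega> \<in> (\<Union>t\<in>T. D q t))" for q
  proof -
    obtain \<B> where \<B>: "\<B> \<subseteq> D q ` S" "countable \<B>"
      "\<forall>A\<in>D q ` S. AE \<omega> in M. \<omega> \<in> A \<longrightarrow> \<omega> \<in> \<Union>\<B>" using * by meson
    then obtain T where "T \<subseteq> S" "countable T" "\<B> = D q ` T"
      using countable_subset_image[of \<B> "D q" S] by blast
    then show "\<exists>T. T \<subseteq> S \<and> countable T \<and> (\<forall>s\<in>S. AE \<omega> in M. \<omega> \<in> D q s \<longrightarrow> \<omega> \<in> (\<Union>t\<in>T. D q t))"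
      using \<B>(3) by (intro exI[of _ T]) auto
  qed
  then obtain T where T: "\<And>q. T q \<subseteq> S" "\<And>q. countable (T q)"
    "\<And>q s. s \<in> S \<Longrightarrow> AE \<omega> in M. \<omega> \<in> D q s \<longrightarrow> \<omega> \<in> (\<Union>t\<in>T q. D q t)" by metis
  show thesis
  proof (rule that[of "\<Union>q. T q"])
    fix s assume "s \<in> S"
    then have "AE \<omega> in M. \<forall>q. \<omega> \<in> D q s \<longrightarrow> \<omega> \<in> (\<Union>t\<in>T q. D q t)"
      using T(3) by (subst AE_all_countable) auto
    then show "AE \<omega> in M. s \<omega> \<le> (SUP t\<in>\<Union>q. T q. t \<omega>)"
    proof (rule AE_mp, intro AE_I2 impI)
      fix \<omega> assume w: "\<omega> \<in> space M" and H: "\<forall>q. \<omega> \<in> D q s \<longrightarrow> \<omega> \<in> (\<Union>t\<in>T q. D q t)"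
      show "s \<omega> \<le> (SUP t\<in>\<Union>q. T q. t \<omega>)"
      proof (rule ccontr)
        assume "\<not> ?thesis"
        \<comment> \<open>The end points may be infinite, whereas the rationals are dense between
          real numbers; hence two reals are inserted before the rational.\<close>
        then obtain r where r: "(SUP t\<in>\<Union>q. T q. t \<omega>) < ereal r" "ereal r < s \<omega>"
          using ereal_dense2 by (meson not_le)
        then obtain r' where r': "ereal r < ereal r'" "ereal r' < s \<omega>" using ereal_dense2 by blast
        then obtain q where q: "r < of_rat q" "of_rat q < r'" using of_rat_dense by auto
        then have "\<omega> \<in> D q s" using w r' by (auto simp: D_def intro: less_trans[of _ "ereal r'"])
        then obtain t where t: "t \<in> T q" "ereal (of_rat q) < t \<omega>" using H by (auto simp: D_def)
        have "t \<omega> \<le> (SUP t\<in>\<Union>q. T q. t \<omega>)" using t(1) by (intro SUP_upper) auto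
        with t(2) r(1) q(1) have "ereal (of_rat q) < ereal r" by order
        then show False using q(1) by simp
      qed
    qed
  qed (use T in auto)
qed

text \<open>The member \<open>l\<close> bounds the extended supremum from below and \<open>u\<close>
  bounds it from above, so it is finite almost everywhere and \<open>real_of_ereal\<close> loses
  nothing. Leastness rests on countability: countably many almost sure inequalities hold together
  off one null set.\<close>

lemma (in prob_space) ess_sup_real:
  fixes S :: "('a \<Rightarrow> real) set"
  assumes "S \<subseteq> borel_measurable M" "l \<in> S" "u \<in> borel_measurable M"
    and u: "\<And>s. s \<in> S \<Longrightarrow> AE \<omega> in M. s \<omega> \<le> u \<omega>"
  obtains g where "g \<in> borel_measurable M" "\<And>s. s \<in> S \<Longrightarrow> AE \<omega> in M. s \<omega> \<le> g \<omega>"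
    "\<And>h. h \<in> borel_measurable M \<Longrightarrow> (\<And>s. s \<in> S \<Longrightarrow> AE \<omega> in M. s \<omega> \<le> h \<omega>) \<Longrightarrow> AE \<omega> in M. g \<omega> \<le> h \<omega>"
proof -
  have "(\<lambda>s \<omega>. ereal (s \<omega>)) ` S \<subseteq> borel_measurable M" using assms(1) by auto
  then obtain T' where "T' \<subseteq> (\<lambda>s \<omega>. ereal (s \<omega>)) ` S" "countable T'"
    and T': "\<And>s. s \<in> (\<lambda>s \<omega>. ereal (s \<omega>)) ` S \<Longrightarrow> AE \<omega> in M. s \<omega> \<le> (SUP t\<in>T'. t \<omega>)"
    by (rule countable_essential_supremum) blast
  from conjI[OF this(2) this(1), unfolded countable_subset_image]
  obtain T where T: "countable T" "T \<subseteq> S" "T' = (\<lambda>s \<omega>. ereal (s \<omega>)) ` T"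
    by (elim exE conjE) (rule that)
  define G where "G = (\<lambda>\<omega>. SUP t\<in>T. ereal (t \<omega>))"
  have G: "AE \<omega> in M. ereal (s \<omega>) \<le> G \<omega>" if "s \<in> S" for s
    using T'[of "\<lambda>\<omega>. ereal (s \<omega>)"] that by (simp add: T(3) G_def image_image)
  have le: "AE \<omega> in M. G \<omega> \<le> ereal (h \<omega>)" if "\<And>s. s \<in> S \<Longrightarrow> AE \<omega> in M. s \<omega> \<le> h \<omega>" for h
  proof -
    have "AE \<omega> in M. \<forall>t\<in>T. t \<omega> \<le> h \<omega>" using T that by (subst AE_ball_countable) auto
    then show ?thesis by eventually_elim (auto simp: G_def intro: SUP_least)
  qed
  have fin: "AE \<omega> in M. \<bar>G \<omega>\<bar> \<noteq> \<infinity>"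
    using G[OF \<open>l \<in> S\<close>] le[of u, OF u, simplified] by eventually_elim auto
  have meas: "G \<in> borel_measurable M" unfolding G_def
    using T assms(1) by (intro borel_measurable_SUP) auto
  show thesis
  proof (rule that[of "\<lambda>\<omega>. real_of_ereal (G \<omega>)"])
    show "(\<lambda>\<omega>. real_of_ereal (G \<omega>)) \<in> borel_measurable M" using meas by measurable
    show "AE \<omega> in M. s \<omega> \<le> real_of_ereal (G \<omega>)" if "s \<in> S" for s
      using G[OF that] fin by eventually_elim (auto simp flip: ereal_less_eq(3) simp: ereal_real)
    show "AE \<omega> in M. real_of_ereal (G \<omega>) \<le> h \<omega>" if "\<And>s. s \<in> S \<Longrightarrow> AE \<omega> in M. s \<omega> \<le> h \<omega>" for h
      using le[of h, OF that, simplified] fin by eventually_elim (auto simp flip: ereal_less_eq(3) simp: ereal_real)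
  qed
qed

text \<open>The lattice supremum is picked by a choice operator, so nothing is known of it until
  some least upper bound exists. The pointwise supremum over a countable essential subfamily
  provides one, for families of any cardinality.\<close>

lemma L0_bar_Sup_least:
  assumes "prob_space P" "S \<subseteq> L0 P UNIV"
  shows "least (L0_bar P) (\<Squnion>\<^bsub>L0_bar P\<^esub> S) (Upper (L0_bar P) S)"
proof -
  interpret prob_space P by fact
  have "rep ` S \<subseteq> borel_measurable P" using rep_rv[of _ P UNIV] assms(2) by auto
  then obtain T' where "T' \<subseteq> rep ` S" "countable T'"
    and T': "\<And>s. s \<in> rep ` S \<Longrightarrow> AE \<omega> in P. s \<omega> \<le> (SUP t\<in>T'. t \<omega>)"
    by (rule countable_essential_supremum) blast
  from conjI[OF this(2) this(1), unfolded countable_subset_image]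
  obtain T where T: "countable T" "T \<subseteq> S" "T' = rep ` T"
    by (elim exE conjE) (rule that)
  define G where "G = (\<lambda>\<omega>. SUP X\<in>T. rep X \<omega>)"
  have G: "G \<in> rv P UNIV" unfolding G_def
    using T assms(2) rep_rv[of _ P UNIV] by (auto intro!: borel_measurable_SUP)
  note r = rep_class[OF G]
  have up: "L0_le P X (L0_class P UNIV G)" if "X \<in> S" for X
  proof -
    have "AE \<omega> in P. rep X \<omega> \<le> G \<omega>"
      using T'[of "rep X"] that by (simp add: T(3) G_def image_image)
    then show ?thesis unfolding L0_le_def using r by eventually_elim simp
  qed
  have "L0_le P (L0_class P UNIV G) Y" if "\<And>X. X \<in> S \<Longrightarrow> L0_le P X Y" for Y
  proof -
    have "AE \<omega> in P. \<forall>X\<in>T. rep X \<omega> \<le> rep Y \<omega>"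
      using T that by (subst AE_ball_countable) (auto simp: L0_le_def)
    then show ?thesis unfolding L0_le_def using r
      by eventually_elim (auto simp: G_def intro: SUP_least)
  qed
  then have "least (L0_bar P) (L0_class P UNIV G) (Upper (L0_bar P) S)"
    using up L0_class_in[OF G] assms(2) by (auto simp: least_def Upper_def L0_bar_def)
  then show ?thesis unfolding sup_def by (rule someI)
qed

text \<open>Suprema are used below only through these two facts; the equivalence turns a bound on a
  supremum into separate almost sure inequalities.\<close>

lemma
  assumes "prob_space P" "S \<subseteq> L0 P UNIV"
  shows L0_bar_Sup_closed: "\<Squnion>\<^bsub>L0_bar P\<^esub> S \<in> L0 P UNIV"
    and L0_bar_Sup_le_iff: "Y \<in> L0 P UNIV \<Longrightarrow> L0_le P (\<Squnion>\<^bsub>L0_bar P\<^esub> S) Y \<longleftrightarrow> (\<forall>X\<in>S. L0_le P X Y)"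
proof -
  note l = L0_bar_Sup_least[OF assms]
  show c: "\<Squnion>\<^bsub>L0_bar P\<^esub> S \<in> L0 P UNIV"
    using l by (auto simp: least_def Upper_def L0_bar_def)
  have up: "L0_le P X (\<Squnion>\<^bsub>L0_bar P\<^esub> S)" if "X \<in> S" for X
    using l assms(2) that by (auto simp: least_def Upper_def L0_bar_def)
  assume Y: "Y \<in> L0 P UNIV"
  show "L0_le P (\<Squnion>\<^bsub>L0_bar P\<^esub> S) Y \<longleftrightarrow> (\<forall>X\<in>S. L0_le P X Y)"
  proof
    assume "L0_le P (\<Squnion>\<^bsub>L0_bar P\<^esub> S) Y"
    then have "L0_le P X Y" if "X \<in> S" for X
      using up[OF that] unfolding L0_le_def by eventually_elim simp
    then show "\<forall>X\<in>S. L0_le P X Y" by blast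
  next
    assume "\<forall>X\<in>S. L0_le P X Y"
    then show "L0_le P (\<Squnion>\<^bsub>L0_bar P\<^esub> S) Y"
      using l Y by (auto simp: least_def Upper_def L0_bar_def)
  qed
qed

section \<open>Module operations through representatives\<close>

lemma
  assumes "K = \<real> \<or> K = (UNIV :: complex set)"
  shows rv_of_real: "r \<in> borel_measurable P \<Longrightarrow> (\<lambda>\<omega>. complex_of_real (r \<omega>)) \<in> rv P K"
    and rv_add: "c \<in> rv P K \<Longrightarrow> d \<in> rv P K \<Longrightarrow> (\<lambda>\<omega>. c \<omega> + d \<omega>) \<in> rv P K"
    and rv_mult: "c \<in> rv P K \<Longrightarrow> d \<in> rv P K \<Longrightarrow> (\<lambda>\<omega>. c \<omega> * d \<omega>) \<in> rv P K"
  using assms by (auto simp: rv_iff)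

lemma rv_measurable: "c \<in> rv P V \<Longrightarrow> c \<in> borel_measurable P"
  by (simp add: rv_iff)

lemma L0_class_add:
  assumes "K = \<real> \<or> K = UNIV" "c \<in> rv P K" "d \<in> rv P K"
  shows "L0_class P K c \<oplus>\<^bsub>L0_alg P K\<^esub> L0_class P K d = L0_class P K (\<lambda>\<omega>. c \<omega> + d \<omega>)"
proof -
  have "AE \<omega> in P. rep (L0_class P K c) \<omega> + rep (L0_class P K d) \<omega> = c \<omega> + d \<omega>"
    using rep_class[OF assms(2)] rep_class[OF assms(3)] by eventually_elim simp
  then have "L0_class P K (\<lambda>\<omega>. rep (L0_class P K c) \<omega> + rep (L0_class P K d) \<omega>) =
      L0_class P K (\<lambda>\<omega>. c \<omega> + d \<omega>)"
    using assms(2,3) by (intro class_eq rv_add[OF assms(1)] rep_rv L0_class_in)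
  then show ?thesis by (simp add: L0_alg_def)
qed

lemma L0_class_mult:
  assumes "K = \<real> \<or> K = UNIV" "c \<in> rv P K" "d \<in> rv P K"
  shows "L0_class P K c \<otimes>\<^bsub>L0_alg P K\<^esub> L0_class P K d = L0_class P K (\<lambda>\<omega>. c \<omega> * d \<omega>)"
proof -
  have "AE \<omega> in P. rep (L0_class P K c) \<omega> * rep (L0_class P K d) \<omega> = c \<omega> * d \<omega>"
    using rep_class[OF assms(2)] rep_class[OF assms(3)] by eventually_elim simp
  then have "L0_class P K (\<lambda>\<omega>. rep (L0_class P K c) \<omega> * rep (L0_class P K d) \<omega>) =
      L0_class P K (\<lambda>\<omega>. c \<omega> * d \<omega>)"
    using assms(2,3) by (intro class_eq rv_mult[OF assms(1)] rep_rv L0_class_in)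
  then show ?thesis by (simp add: L0_alg_def)
qed

context random_locally_convex_module
begin

text \<open>For either \<open>K\<close>, this makes \<open>E\<close> a module over the real random
  variables, which is all that the Hahn-Banach part sees. Coefficients are functions rather than
  classes, so that they can be manipulated pointwise; \<open>scal_cong\<close> shows that null sets
  do not matter.\<close>

definition scal :: "('w \<Rightarrow> real) \<Rightarrow> 'e \<Rightarrow> 'e" where
  "scal r e = L0_class P K (\<lambda>\<omega>. complex_of_real (r \<omega>)) \<odot> e"

lemma class_carrier: "c \<in> rv P K \<Longrightarrow> L0_class P K c \<in> carrier (L0_alg P K)"
  by (simp add: L0_alg_def L0_class_in)

lemma class_of_real_carrier:
  "r \<in> borel_measurable P \<Longrightarrow> L0_class P K (\<lambda>\<omega>. complex_of_real (r \<omega>)) \<in> carrier (L0_alg P K)"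
  by (intro class_carrier rv_of_real[OF scalar_field])

lemma scal_closed [simp, intro]:
  "r \<in> borel_measurable P \<Longrightarrow> e \<in> carrier E \<Longrightarrow> scal r e \<in> carrier E"
  by (simp add: scal_def class_of_real_carrier)

lemma scal_add_left:
  assumes "r \<in> borel_measurable P" "s \<in> borel_measurable P" "e \<in> carrier E"
  shows "scal (\<lambda>\<omega>. r \<omega> + s \<omega>) e = scal r e \<oplus> scal s e"
  using L0_class_add[OF scalar_field rv_of_real[OF scalar_field assms(1)] rv_of_real[OF scalar_field assms(2)]]
    smult_l_distr[OF class_of_real_carrier[OF assms(1)] class_of_real_carrier[OF assms(2)] assms(3)]
  by (simp add: scal_def)

lemma scal_add_right:
  assumes "r \<in> borel_measurable P" "e \<in> carrier E" "e' \<in> carrier E"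
  shows "scal r (e \<oplus> e') = scal r e \<oplus> scal r e'"
  using smult_r_distr[OF class_of_real_carrier[OF assms(1)] assms(2,3)] by (simp add: scal_def)

lemma scal_mult:
  assumes "r \<in> borel_measurable P" "s \<in> borel_measurable P" "e \<in> carrier E"
  shows "scal (\<lambda>\<omega>. r \<omega> * s \<omega>) e = scal r (scal s e)"
  using L0_class_mult[OF scalar_field rv_of_real[OF scalar_field assms(1)] rv_of_real[OF scalar_field assms(2)]]
    smult_assoc1[OF class_of_real_carrier[OF assms(1)] class_of_real_carrier[OF assms(2)] assms(3)]
  by (simp add: scal_def)

lemma scal_cong:
  assumes "r \<in> borel_measurable P" "s \<in> borel_measurable P" "AE \<omega> in P. r \<omega> = s \<omega>"
  shows "scal r e = scal s e"
proof -
  have "L0_class P K (\<lambda>\<omega>. complex_of_real (r \<omega>)) = L0_class P K (\<lambda>\<omega>. complex_of_real (s \<omega>))"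
    using assms by (intro class_eq rv_of_real[OF scalar_field]) auto
  then show ?thesis by (simp add: scal_def)
qed

lemma scal_one: "e \<in> carrier E \<Longrightarrow> scal (\<lambda>\<omega>. 1) e = e"
  using smult_one[of e] by (simp add: scal_def L0_alg_def)

lemma scal_zero: "e \<in> carrier E \<Longrightarrow> scal (\<lambda>\<omega>. 0) e = \<zero>"
  using smult_l_null[of e] by (simp add: scal_def L0_alg_def)

lemma scal_minus_right:
  "r \<in> borel_measurable P \<Longrightarrow> e \<in> carrier E \<Longrightarrow> scal r (\<ominus> e) = \<ominus> scal r e"
  using smult_r_minus[OF class_of_real_carrier] by (simp add: scal_def)

lemma scal_minus_left:
  assumes "r \<in> borel_measurable P" "e \<in> carrier E"
  shows "scal (\<lambda>\<omega>. - r \<omega>) e = \<ominus> scal r e"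
proof -
  have "scal (\<lambda>\<omega>. - r \<omega>) e \<oplus> scal r e = scal (\<lambda>\<omega>. - r \<omega> + r \<omega>) e"
    using assms by (subst scal_add_left) auto
  then have "scal (\<lambda>\<omega>. - r \<omega>) e \<oplus> scal r e = \<zero>" using assms(2) by (simp add: scal_zero)
  then show ?thesis using assms by (intro minus_equality[symmetric]) auto
qed

end

section \<open>Extension of cones to module homomorphisms\<close>

locale L0_sublinear = random_locally_convex_module P K E \<P>
  for P :: "'w measure"
    and K :: "complex set"
    and E :: "(('w \<Rightarrow> complex) set, 'e, 'm) module_scheme" (structure)
    and \<P> :: "('e \<Rightarrow> ('w \<Rightarrow> real) set) set" +
  fixes N :: "'e \<Rightarrow> 'w \<Rightarrow> real"
  assumes N_measurable [measurable, simp]: "e \<in> carrier E \<Longrightarrow> N e \<in> borel_measurable P"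
    and N_scal: "t \<in> borel_measurable P \<Longrightarrow> e \<in> carrier E \<Longrightarrow>
      AE \<omega> in P. N (scal t e) \<omega> = \<bar>t \<omega>\<bar> * N e \<omega>"
    and N_add: "e \<in> carrier E \<Longrightarrow> e' \<in> carrier E \<Longrightarrow>
      AE \<omega> in P. N (e \<oplus> e') \<omega> \<le> N e \<omega> + N e' \<omega>"
begin

lemma N_minus: assumes "e \<in> carrier E" shows "AE \<omega> in P. N (\<ominus> e) \<omega> = N e \<omega>"
proof -
  have "scal (\<lambda>\<omega>. - 1) e = \<ominus> e" using scal_minus_left[of "\<lambda>\<omega>. 1" e] assms by (simp add: scal_one)
  then show ?thesis using N_scal[of "\<lambda>\<omega>. - 1" e] assms by simp
qed

lemma N_zero: "AE \<omega> in P. N \<zero> \<omega> = 0"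
  using N_scal[of "\<lambda>\<omega>. 0" \<zero>] by (simp add: scal_zero)

text \<open>A pair \<open>(c, s)\<close> in a cone records the demand \<open>s \<le> F c\<close> on the homomorphism \<open>F\<close> to be found.\<close>

definition is_cone :: "('e \<times> ('w \<Rightarrow> real)) set \<Rightarrow> bool" where
  "is_cone C \<longleftrightarrow>
    (\<forall>c s. (c, s) \<in> C \<longrightarrow> c \<in> carrier E \<and> s \<in> borel_measurable P \<and> (AE \<omega> in P. s \<omega> \<le> N c \<omega>)) \<and>
    (\<forall>e\<in>carrier E. (e, \<lambda>\<omega>. - N e \<omega>) \<in> C) \<and>
    (\<forall>c s d r. (c, s) \<in> C \<longrightarrow> (d, r) \<in> C \<longrightarrow> (c \<oplus> d, \<lambda>\<omega>. s \<omega> + r \<omega>) \<in> C) \<and>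
    (\<forall>c s t. (c, s) \<in> C \<longrightarrow> t \<in> borel_measurable P \<longrightarrow> (\<forall>\<omega>. 0 \<le> t \<omega>) \<longrightarrow>
      (scal t c, \<lambda>\<omega>. t \<omega> * s \<omega>) \<in> C)"

lemma
  assumes "is_cone C"
  shows cone_fst: "(c, s) \<in> C \<Longrightarrow> c \<in> carrier E"
    and cone_snd: "(c, s) \<in> C \<Longrightarrow> s \<in> borel_measurable P"
    and cone_le: "(c, s) \<in> C \<Longrightarrow> AE \<omega> in P. s \<omega> \<le> N c \<omega>"
    and cone_N: "e \<in> carrier E \<Longrightarrow> (e, \<lambda>\<omega>. - N e \<omega>) \<in> C"
    and cone_add: "(c, s) \<in> C \<Longrightarrow> (d, r) \<in> C \<Longrightarrow> (c \<oplus> d, \<lambda>\<omega>. s \<omega> + r \<omega>) \<in> C"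
    and cone_scal: "(c, s) \<in> C \<Longrightarrow> t \<in> borel_measurable P \<Longrightarrow> (\<And>\<omega>. 0 \<le> t \<omega>) \<Longrightarrow>
      (scal t c, \<lambda>\<omega>. t \<omega> * s \<omega>) \<in> C"
  using assms unfolding is_cone_def by meson+

text \<open>Zorn's lemma for inclusion. Closure under addition is the only clause about two
  arbitrary members of the cone, and in a chain both lie in the larger of two sets.\<close>

lemma maximal_cone:
  assumes "is_cone C\<^sub>0"
  obtains C where "is_cone C" "C\<^sub>0 \<subseteq> C" "\<And>C'. is_cone C' \<Longrightarrow> C \<subseteq> C' \<Longrightarrow> C' = C"
proof -
  define \<C> where "\<C> = {C. is_cone C \<and> C\<^sub>0 \<subseteq> C}"
  have "\<exists>C\<in>\<C>. \<forall>X\<in>\<C>. C \<subseteq> X \<longrightarrow> X = C"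
  proof (rule subset_Zorn_nonempty)
    show "\<C> \<noteq> {}" using assms by (auto simp: \<C>_def)
    fix X assume X: "X \<noteq> {}" "subset.chain \<C> X"
    then have cone: "is_cone C" if "C \<in> X" for C using that by (auto simp: subset.chain_def \<C>_def)
    have add: "(c \<oplus> d, \<lambda>\<omega>. s \<omega> + r \<omega>) \<in> \<Union>X" if cd: "(c, s) \<in> \<Union>X" "(d, r) \<in> \<Union>X" for c s d r
    proof -
      obtain A B where AB: "A \<in> X" "(c, s) \<in> A" "B \<in> X" "(d, r) \<in> B" using cd by auto
      then have "A \<subseteq> B \<or> B \<subseteq> A" using X(2) by (auto simp: subset.chain_def)
      then show ?thesis using AB cone cone_add by (meson UnionI subsetD)
    qed
    obtain A where A: "A \<in> X" using X by auto
    have "is_cone (\<Union>X)" unfolding is_cone_def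
    proof (intro conjI[of "\<forall>c s d r. _ c s d r"] conjI[of "Ball _ _"] conjI[of "All _"] allI impI ballI)
      show "(e, \<lambda>\<omega>. - N e \<omega>) \<in> \<Union>X" if "e \<in> carrier E" for e
        using cone_N[OF cone[OF A] that] A by auto
    next
      fix c s assume "(c, s) \<in> \<Union>X"
      then obtain B where B: "B \<in> X" "(c, s) \<in> B" by auto
      show "c \<in> carrier E \<and> s \<in> borel_measurable P \<and> (AE \<omega> in P. s \<omega> \<le> N c \<omega>)"
        using cone_fst[OF cone] cone_snd[OF cone] cone_le[OF cone] B by blast
      show "(scal t c, \<lambda>\<omega>. t \<omega> * s \<omega>) \<in> \<Union>X"
        if "t \<in> borel_measurable P" "\<forall>\<omega>. 0 \<le> t \<omega>" for t
        using cone_scal[OF cone[OF B(1)] B(2) that(1)] that(2) B(1) by blast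
    qed (rule add)
    moreover have "C\<^sub>0 \<subseteq> A" using A X by (auto simp: subset.chain_def \<C>_def)
    then have "C\<^sub>0 \<subseteq> \<Union>X" using A by blast
    ultimately show "\<Union>X \<in> \<C>" by (simp add: \<C>_def)
  qed
  then obtain C where "C \<in> \<C>" and max: "\<And>X. X \<in> \<C> \<Longrightarrow> C \<subseteq> X \<Longrightarrow> X = C" by auto
  moreover have "X = C" if "is_cone X" "C \<subseteq> X" for X
    using that \<open>C \<in> \<C>\<close> by (intro max) (auto simp: \<C>_def)
  ultimately show thesis using that by (auto simp: \<C>_def)
qed

text \<open>The best lower bound demanded by a cone is a superlinear map; for a maximal cone it is odd,
  hence linear.\<close>

definition is_bound :: "('e \<times> ('w \<Rightarrow> real)) set \<Rightarrow> ('e \<Rightarrow> 'w \<Rightarrow> real) \<Rightarrow> bool" where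
  "is_bound C F \<longleftrightarrow> (\<forall>e\<in>carrier E. F e \<in> borel_measurable P \<and>
    (\<forall>s. (e, s) \<in> C \<longrightarrow> (AE \<omega> in P. s \<omega> \<le> F e \<omega>)) \<and>
    (\<forall>h\<in>borel_measurable P. (\<forall>s. (e, s) \<in> C \<longrightarrow> (AE \<omega> in P. s \<omega> \<le> h \<omega>)) \<longrightarrow>
      (AE \<omega> in P. F e \<omega> \<le> h \<omega>)))"

lemma
  assumes "is_bound C F" "e \<in> carrier E"
  shows bound_measurable: "F e \<in> borel_measurable P"
    and bound_upper: "(e, s) \<in> C \<Longrightarrow> AE \<omega> in P. s \<omega> \<le> F e \<omega>"
    and bound_least: "h \<in> borel_measurable P \<Longrightarrow>
      (\<And>s. (e, s) \<in> C \<Longrightarrow> AE \<omega> in P. s \<omega> \<le> h \<omega>) \<Longrightarrow> AE \<omega> in P. F e \<omega> \<le> h \<omega>"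
  using assms unfolding is_bound_def by meson+

text \<open>The demands on \<open>e\<close> include \<open>- N e\<close> and stay below
  \<open>N e\<close>, so their essential supremum is real valued. It is determined only up to null
  sets; \<open>F\<close> selects one version for each \<open>e\<close>.\<close>

lemma bound_exists:
  assumes C: "is_cone C"
  obtains F where "is_bound C F"
proof -
  have "\<exists>g. g \<in> borel_measurable P \<and> (\<forall>s. (e, s) \<in> C \<longrightarrow> (AE \<omega> in P. s \<omega> \<le> g \<omega>)) \<and>
    (\<forall>h\<in>borel_measurable P. (\<forall>s. (e, s) \<in> C \<longrightarrow> (AE \<omega> in P. s \<omega> \<le> h \<omega>)) \<longrightarrow>
      (AE \<omega> in P. g \<omega> \<le> h \<omega>))" if e: "e \<in> carrier E" for e
  proof -
    have 1: "{s. (e, s) \<in> C} \<subseteq> borel_measurable P" using cone_snd[OF C] by auto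
    have 2: "(\<lambda>\<omega>. - N e \<omega>) \<in> {s. (e, s) \<in> C}" using cone_N[OF C e] by simp
    have 3: "AE \<omega> in P. s \<omega> \<le> N e \<omega>" if "s \<in> {s. (e, s) \<in> C}" for s using cone_le[OF C] that by simp
    obtain g where g: "g \<in> borel_measurable P"
      "\<And>s. s \<in> {s. (e, s) \<in> C} \<Longrightarrow> AE \<omega> in P. s \<omega> \<le> g \<omega>"
      "\<And>h. h \<in> borel_measurable P \<Longrightarrow> (\<And>s. s \<in> {s. (e, s) \<in> C} \<Longrightarrow> AE \<omega> in P. s \<omega> \<le> h \<omega>) \<Longrightarrow>
        AE \<omega> in P. g \<omega> \<le> h \<omega>"
      using ess_sup_real[OF 1 2 N_measurable[OF e] 3] by blast
    show ?thesis
    proof (intro exI[of _ g] conjI allI impI ballI)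
      show "AE \<omega> in P. g \<omega> \<le> h \<omega>"
        if "h \<in> borel_measurable P" "\<forall>s. (e, s) \<in> C \<longrightarrow> (AE \<omega> in P. s \<omega> \<le> h \<omega>)" for h
        using that by (intro g(3)) auto
    qed (use g in auto)
  qed
  then have "\<exists>F. is_bound C F" unfolding is_bound_def by (intro bchoice) blast
  then show thesis using that by blast
qed

section \<open>Superlinearity of the best lower bound\<close>

context
  fixes C F
  assumes C: "is_cone C" and F: "is_bound C F"
begin

lemma bound_le_N: assumes "e \<in> carrier E" shows "AE \<omega> in P. F e \<omega> \<le> N e \<omega>"
  using assms by (intro bound_least[OF F] cone_le[OF C]) auto

lemma bound_ge_N: assumes "e \<in> carrier E" shows "AE \<omega> in P. - N e \<omega> \<le> F e \<omega>"
  using bound_upper[OF F assms cone_N[OF C assms]] .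

text \<open>Demands on \<open>e\<close> and \<open>e'\<close> add up to demands on the sum. The two
  essential suprema are taken one after the other: \<open>s'\<close> is held fixed while
  \<open>s\<close> varies, and leastness is then used again for \<open>s'\<close>.\<close>

lemma bound_superadditive:
  assumes e: "e \<in> carrier E" "e' \<in> carrier E"
  shows "AE \<omega> in P. F e \<omega> + F e' \<omega> \<le> F (e \<oplus> e') \<omega>"
proof -
  note [measurable] = bound_measurable[OF F e(1)] bound_measurable[OF F e(2)]
    bound_measurable[OF F M.a_closed[OF e]]
  have "AE \<omega> in P. F e \<omega> \<le> F (e \<oplus> e') \<omega> - s' \<omega>" if s': "(e', s') \<in> C" for s'
  proof (rule bound_least[OF F e(1)])
    have [measurable]: "s' \<in> borel_measurable P" using cone_snd[OF C s'] .
    show "(\<lambda>\<omega>. F (e \<oplus> e') \<omega> - s' \<omega>) \<in> borel_measurable P" by measurable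
    fix s assume "(e, s) \<in> C"
    then have "AE \<omega> in P. s \<omega> + s' \<omega> \<le> F (e \<oplus> e') \<omega>"
      using e s' by (intro bound_upper[OF F] cone_add[OF C]) auto
    then show "AE \<omega> in P. s \<omega> \<le> F (e \<oplus> e') \<omega> - s' \<omega>" by eventually_elim simp
  qed
  then have "AE \<omega> in P. F e' \<omega> \<le> F (e \<oplus> e') \<omega> - F e \<omega>"
  proof (intro bound_least[OF F e(2)])
    show "(\<lambda>\<omega>. F (e \<oplus> e') \<omega> - F e \<omega>) \<in> borel_measurable P" by measurable
    fix s' assume *: "\<And>s'. (e', s') \<in> C \<Longrightarrow> AE \<omega> in P. F e \<omega> \<le> F (e \<oplus> e') \<omega> - s' \<omega>" "(e', s') \<in> C"
    show "AE \<omega> in P. s' \<omega> \<le> F (e \<oplus> e') \<omega> - F e \<omega>"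
      using *(1)[OF *(2)] by eventually_elim simp
  qed
  then show ?thesis by eventually_elim simp
qed

lemma bound_scal_ge:
  assumes t [measurable]: "t \<in> borel_measurable P" and pos: "\<And>\<omega>. 0 \<le> t \<omega>" and e: "e \<in> carrier E"
  shows "AE \<omega> in P. t \<omega> * F e \<omega> \<le> F (scal t e) \<omega>"
proof -
  note [measurable] = bound_measurable[OF F e] bound_measurable[OF F scal_closed[OF t e]] N_measurable[OF e]
  \<comment> \<open>The demands on \<open>scal t e\<close> say nothing about \<open>e\<close> where
    \<open>t\<close> vanishes. There \<open>N e\<close> serves as the default, since it bounds every
    demand on \<open>e\<close>.\<close>
  have "AE \<omega> in P. F e \<omega> \<le> (if 0 < t \<omega> then F (scal t e) \<omega> / t \<omega> else N e \<omega>)"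
  proof (rule bound_least[OF F e])
    fix s assume s: "(e, s) \<in> C"
    have "AE \<omega> in P. t \<omega> * s \<omega> \<le> F (scal t e) \<omega>"
      using e pos by (intro bound_upper[OF F] cone_scal[OF C s]) auto
    then show "AE \<omega> in P. s \<omega> \<le> (if 0 < t \<omega> then F (scal t e) \<omega> / t \<omega> else N e \<omega>)"
      using cone_le[OF C s] by eventually_elim (simp add: field_simps)
  qed measurable
  \<comment> \<open>Where \<open>t\<close> vanishes this reads \<open>0 \<le> F (scal t e)\<close>,
    the inequality missing from the division argument.\<close>
  moreover have "AE \<omega> in P. - (\<bar>t \<omega>\<bar> * N e \<omega>) \<le> F (scal t e) \<omega>"
    using bound_ge_N[OF scal_closed[OF t e]] N_scal[OF t e] by eventually_elim simp
  ultimately show ?thesis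
  proof eventually_elim
    case (elim \<omega>)
    then show ?case using pos[of \<omega>] by (cases "t \<omega> = 0") (auto simp: field_simps)
  qed
qed

text \<open>The reverse inequality would follow by scaling back with the inverse of
  \<open>t\<close>, but that only recovers the part of \<open>e\<close> living where
  \<open>t\<close> is nonzero. The remaining part is added by superadditivity; where
  \<open>t\<close> is nonzero its seminorm vanishes, so its bound is nonnegative there and does no
  harm.\<close>

lemma bound_scal:
  assumes t [measurable]: "t \<in> borel_measurable P" and pos: "\<And>\<omega>. 0 \<le> t \<omega>" and e: "e \<in> carrier E"
  shows "AE \<omega> in P. F (scal t e) \<omega> = t \<omega> * F e \<omega>"
proof -
  let ?i = "\<lambda>\<omega>. inverse (t \<omega>)" and ?a = "\<lambda>\<omega>. if t \<omega> = 0 then 0 else 1 :: real"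
    and ?b = "\<lambda>\<omega>. if t \<omega> = 0 then 1 else 0 :: real"
  \<comment> \<open>By the convention \<open>inverse 0 = 0\<close>, the product of \<open>t\<close>
    and its inverse is the indicator of the event that \<open>t\<close> is nonzero.\<close>
  have e': "scal ?i (scal t e) = scal ?a e"
    using e by (subst scal_mult[symmetric]) (auto intro!: scal_cong)
  have "scal (\<lambda>\<omega>. ?a \<omega> + ?b \<omega>) e = scal (\<lambda>\<omega>. 1) e" by (rule scal_cong) auto
  then have ab: "scal ?a e \<oplus> scal ?b e = e" using e by (subst (asm) scal_add_left) (auto simp: scal_one)
  have sup: "AE \<omega> in P. F (scal ?a e) \<omega> + F (scal ?b e) \<omega> \<le> F e \<omega>"
    using bound_superadditive[of "scal ?a e" "scal ?b e"] e unfolding ab by auto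
  have b: "AE \<omega> in P. - N (scal ?b e) \<omega> \<le> F (scal ?b e) \<omega>" using e by (intro bound_ge_N) auto
  have nb: "AE \<omega> in P. N (scal ?b e) \<omega> = \<bar>?b \<omega>\<bar> * N e \<omega>" using e by (intro N_scal) auto
  have i: "AE \<omega> in P. ?i \<omega> * F (scal t e) \<omega> \<le> F (scal ?a e) \<omega>"
    using e pos unfolding e'[symmetric] by (intro bound_scal_ge) auto
  show ?thesis
    using sup b nb i bound_scal_ge[OF t pos e] bound_le_N[OF scal_closed[OF t e]] N_scal[OF t e]
  proof eventually_elim
    case (elim \<omega>)
    show ?case
    proof (cases "t \<omega> = 0")
      case False
      then have "0 < t \<omega>" using pos[of \<omega>] by auto
      have "inverse (t \<omega>) * F (scal t e) \<omega> \<le> F e \<omega>" using elim False by simp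
      then have "F (scal t e) \<omega> \<le> t \<omega> * F e \<omega>" using \<open>0 < t \<omega>\<close> by (simp add: field_simps)
      then show ?thesis using elim by simp
    qed (use elim in auto)
  qed
qed

section \<open>Linearity of the best lower bound of a maximal cone\<close>

context
  assumes max: "\<And>C'. is_cone C' \<Longrightarrow> C \<subseteq> C' \<Longrightarrow> C' = C"
begin

text \<open>The demand \<open>- F z\<close> on \<open>\<ominus> z\<close> can be adjoined without
  contradicting \<open>N\<close>, because any demand on a vector \<open>t z\<close> is at most
  \<open>t * F z\<close>. Maximality then says that it was in the cone already.\<close>

lemma bound_minus_ge:
  assumes z: "z \<in> carrier E"
  shows "AE \<omega> in P. - F z \<omega> \<le> F (\<ominus> z) \<omega>"
proof -
  note [measurable] = bound_measurable[OF F z]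
  define C' where "C' = {(c \<oplus> \<ominus> scal t z, \<lambda>\<omega>. s \<omega> - t \<omega> * F z \<omega>) |c s t.
    (c, s) \<in> C \<and> t \<in> borel_measurable P \<and> (\<forall>\<omega>. 0 \<le> t \<omega>)}"
  have C'I: "(d, r) \<in> C'" if "(c, s) \<in> C" "t \<in> borel_measurable P" "\<And>\<omega>. 0 \<le> t \<omega>"
    "d = c \<oplus> \<ominus> scal t z" "r = (\<lambda>\<omega>. s \<omega> - t \<omega> * F z \<omega>)" for c s d r t
    unfolding C'_def using that by blast
  have sub: "C \<subseteq> C'"
  proof safe
    fix c s assume cs: "(c, s) \<in> C"
    show "(c, s) \<in> C'"
      by (rule C'I[OF cs, of "\<lambda>\<omega>. 0"]) (use z cone_fst[OF C cs] in \<open>auto simp: scal_zero\<close>)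
  qed
  have "is_cone C'" unfolding is_cone_def
  proof (intro conjI[of "\<forall>c s d r. _ c s d r"] conjI[of "Ball _ _"] conjI[of "All _"] allI impI ballI)
    show "(e, \<lambda>\<omega>. - N e \<omega>) \<in> C'" if "e \<in> carrier E" for e
      using cone_N[OF C that] sub by auto
  next
    fix d r assume "(d, r) \<in> C'"
    then obtain c s t where d: "d = c \<oplus> \<ominus> scal t z" "r = (\<lambda>\<omega>. s \<omega> - t \<omega> * F z \<omega>)"
      and cs: "(c, s) \<in> C" and t [measurable]: "t \<in> borel_measurable P" and pos: "\<And>\<omega>. 0 \<le> t \<omega>"
      unfolding C'_def by blast
    note c = cone_fst[OF C cs] and [measurable] = cone_snd[OF C cs]
    have dE: "d \<in> carrier E" using c z by (simp add: d)
    \<comment> \<open>Consistency of \<open>C'\<close>: the demand \<open>s\<close> on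
      \<open>c\<close> and the demand \<open>- N (\<ominus> d)\<close> on \<open>\<ominus> d\<close>
      add up to one on \<open>scal t z\<close>, so \<open>bound_scal\<close> caps their sum by
      \<open>t * F z\<close>. Rearranged, this is the required \<open>r \<le> N d\<close>.\<close>
    have tz: "scal t z = c \<oplus> \<ominus> d"
      using c z by (simp add: d M.minus_add M.r_neg2)
    have "AE \<omega> in P. s \<omega> + - N (\<ominus> d) \<omega> \<le> F (scal t z) \<omega>" unfolding tz
      using c dE by (intro bound_upper[OF F] cone_add[OF C cs] cone_N[OF C]) auto
    then have "AE \<omega> in P. r \<omega> \<le> N d \<omega>"
      using bound_scal[OF t pos z] N_minus[OF dE] by eventually_elim (simp add: d)
    moreover have "r \<in> borel_measurable P" unfolding d by measurable
    ultimately show "d \<in> carrier E \<and> r \<in> borel_measurable P \<and> (AE \<omega> in P. r \<omega> \<le> N d \<omega>)"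
      using dE by blast
    fix u assume u [measurable]: "u \<in> borel_measurable P" and upos: "\<forall>\<omega>. 0 \<le> (u \<omega> :: real)"
    show "(scal u d, \<lambda>\<omega>. u \<omega> * r \<omega>) \<in> C'"
    proof (rule C'I[OF cone_scal[OF C cs u], of "\<lambda>\<omega>. u \<omega> * t \<omega>"])
      show "scal u d = scal u c \<oplus> \<ominus> scal (\<lambda>\<omega>. u \<omega> * t \<omega>) z"
        using c z by (simp add: d scal_add_right scal_minus_right scal_mult)
      show "(\<lambda>\<omega>. u \<omega> * r \<omega>) = (\<lambda>\<omega>. u \<omega> * s \<omega> - u \<omega> * t \<omega> * F z \<omega>)"
        by (simp add: d algebra_simps)
    qed (use upos pos in auto)
  next
    fix d r d' r' assume "(d, r) \<in> C'" "(d', r') \<in> C'"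
    then obtain c s t c' s' t' where d: "d = c \<oplus> \<ominus> scal t z" "r = (\<lambda>\<omega>. s \<omega> - t \<omega> * F z \<omega>)"
      "d' = c' \<oplus> \<ominus> scal t' z" "r' = (\<lambda>\<omega>. s' \<omega> - t' \<omega> * F z \<omega>)"
      and cs: "(c, s) \<in> C" "(c', s') \<in> C"
      and t [measurable]: "t \<in> borel_measurable P" "t' \<in> borel_measurable P"
      and pos: "\<And>\<omega>. 0 \<le> t \<omega>" "\<And>\<omega>. 0 \<le> t' \<omega>"
      unfolding C'_def by blast
    note c = cone_fst[OF C cs(1)] cone_fst[OF C cs(2)]
    show "(d \<oplus> d', \<lambda>\<omega>. r \<omega> + r' \<omega>) \<in> C'"
    proof (rule C'I[OF cone_add[OF C cs], of "\<lambda>\<omega>. t \<omega> + t' \<omega>"])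
      show "d \<oplus> d' = c \<oplus> c' \<oplus> \<ominus> scal (\<lambda>\<omega>. t \<omega> + t' \<omega>) z"
        using c z t by (simp add: d scal_add_left M.minus_add M.a_ac)
    qed (use pos in \<open>auto simp: d algebra_simps\<close>)
  qed
  from max[OF this sub] have "C' = C" .
  \<comment> \<open>The cone element used is the zero vector with its demand
    \<open>- N \<zero>\<close>. That function is zero only almost everywhere, so the term stays
    until \<open>N_zero\<close> removes it.\<close>
  moreover have "(\<ominus> z, \<lambda>\<omega>. - N \<zero> \<omega> - F z \<omega>) \<in> C'"
    by (rule C'I[OF cone_N[OF C], of \<zero> "\<lambda>\<omega>. 1"]) (use z in \<open>auto simp: scal_one\<close>)
  ultimately have "AE \<omega> in P. - N \<zero> \<omega> - F z \<omega> \<le> F (\<ominus> z) \<omega>"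
    using z by (intro bound_upper[OF F]) auto
  then show ?thesis using N_zero by eventually_elim simp
qed

text \<open>The converse inequality needs no maximality: the bounds of \<open>z\<close> and
  \<open>\<ominus> z\<close> add up to at most \<open>F \<zero>\<close>, which is at most
  \<open>N \<zero>\<close>.\<close>

lemma bound_minus:
  assumes z: "z \<in> carrier E"
  shows "AE \<omega> in P. F (\<ominus> z) \<omega> = - F z \<omega>"
proof -
  have "AE \<omega> in P. F z \<omega> + F (\<ominus> z) \<omega> \<le> F \<zero> \<omega>"
    using bound_superadditive[OF z M.a_inv_closed[OF z]] z by (simp add: M.r_neg)
  then show ?thesis using bound_minus_ge[OF z] bound_le_N[OF M.zero_closed] N_zero
    by eventually_elim simp
qed

text \<open>Superadditivity at the negated vectors, read through oddness, is subadditivity.\<close>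

lemma bound_additive:
  assumes e: "e \<in> carrier E" "e' \<in> carrier E"
  shows "AE \<omega> in P. F (e \<oplus> e') \<omega> = F e \<omega> + F e' \<omega>"
proof -
  have "\<ominus> (e \<oplus> e') = \<ominus> e \<oplus> \<ominus> e'" using e by (simp add: M.minus_add)
  then have "AE \<omega> in P. F (\<ominus> e) \<omega> + F (\<ominus> e') \<omega> \<le> F (\<ominus> (e \<oplus> e')) \<omega>"
    using bound_superadditive[of "\<ominus> e" "\<ominus> e'"] e by simp
  then show ?thesis
    using bound_superadditive[OF e] bound_minus[OF e(1)] bound_minus[OF e(2)] bound_minus[OF M.a_closed[OF e]]
    by eventually_elim simp
qed

lemma bound_homogeneous:
  assumes t [measurable]: "t \<in> borel_measurable P" and e: "e \<in> carrier E"
  shows "AE \<omega> in P. F (scal t e) \<omega> = t \<omega> * F e \<omega>"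
proof -
  let ?p = "\<lambda>\<omega>. max 0 (t \<omega>)" and ?m = "\<lambda>\<omega>. max 0 (- t \<omega>)"
  have "scal t e = scal (\<lambda>\<omega>. ?p \<omega> + - ?m \<omega>) e" by (rule scal_cong) (auto simp: max_def)
  also have "\<dots> = scal ?p e \<oplus> \<ominus> scal ?m e"
    using e by (subst scal_add_left) (auto simp: scal_minus_left)
  finally have eq: "scal t e = scal ?p e \<oplus> \<ominus> scal ?m e" .
  have "AE \<omega> in P. F (scal t e) \<omega> = F (scal ?p e) \<omega> + F (\<ominus> scal ?m e) \<omega>"
    unfolding eq using e by (intro bound_additive) auto
  moreover have "AE \<omega> in P. F (\<ominus> scal ?m e) \<omega> = - F (scal ?m e) \<omega>" using e by (intro bound_minus) auto
  moreover have "AE \<omega> in P. F (scal ?p e) \<omega> = ?p \<omega> * F e \<omega>" using e by (intro bound_scal) auto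
  moreover have "AE \<omega> in P. F (scal ?m e) \<omega> = ?m \<omega> * F e \<omega>" using e by (intro bound_scal) auto
  ultimately show ?thesis by eventually_elim (auto simp: max_def)
qed

end

end

text \<open>The Hahn-Banach theorem in the form used here: lower bounds that form a cone consistent
  with \<open>N\<close> are all met by a single homomorphism. The bound on the absolute value
  combines \<open>F e \<le> N e\<close> with the demand \<open>- N e\<close>.\<close>

theorem cone_extension:
  assumes "is_cone C\<^sub>0"
  obtains F where
    "\<And>e. e \<in> carrier E \<Longrightarrow> F e \<in> borel_measurable P"
    "\<And>e e'. e \<in> carrier E \<Longrightarrow> e' \<in> carrier E \<Longrightarrow> AE \<omega> in P. F (e \<oplus> e') \<omega> = F e \<omega> + F e' \<omega>"
    "\<And>t e. t \<in> borel_measurable P \<Longrightarrow> e \<in> carrier E \<Longrightarrow> AE \<omega> in P. F (scal t e) \<omega> = t \<omega> * F e \<omega>"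
    "\<And>e. e \<in> carrier E \<Longrightarrow> AE \<omega> in P. \<bar>F e \<omega>\<bar> \<le> N e \<omega>"
    "\<And>c s. (c, s) \<in> C\<^sub>0 \<Longrightarrow> AE \<omega> in P. s \<omega> \<le> F c \<omega>"
proof -
  obtain C where C: "is_cone C" and sub: "C\<^sub>0 \<subseteq> C" and max: "\<And>C'. is_cone C' \<Longrightarrow> C \<subseteq> C' \<Longrightarrow> C' = C"
    using maximal_cone[OF assms] by blast
  obtain F where F: "is_bound C F" using bound_exists[OF C] .
  show thesis
  proof (rule that[of F])
    show "AE \<omega> in P. \<bar>F e \<omega>\<bar> \<le> N e \<omega>" if "e \<in> carrier E" for e
      using bound_le_N[OF C F that] bound_ge_N[OF C F that] by eventually_elim auto
    show "AE \<omega> in P. s \<omega> \<le> F c \<omega>" if "(c, s) \<in> C\<^sub>0" for c s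
      using sub that cone_fst[OF assms that] by (intro bound_upper[OF F]) auto
  qed (use bound_measurable[OF F] bound_additive[OF C F max] bound_homogeneous[OF C F max] in blast)+
qed

end

section \<open>Seminorms and neighbourhoods through representatives\<close>

lemma L0_ext_closed: "X \<in> L0 P UNIV \<Longrightarrow> L0_ext P X \<in> L0 P UNIV"
  unfolding L0_ext_def using rep_rv[of X P UNIV] by (intro L0_class_in) auto

lemma rep_L0_ext: "X \<in> L0 P UNIV \<Longrightarrow> AE \<omega> in P. rep (L0_ext P X) \<omega> = ereal (rep X \<omega>)"
  unfolding L0_ext_def using rep_rv[of X P UNIV] by (intro rep_class) auto

lemma L0_le_ext_iff:
  assumes "X \<in> L0 P UNIV" "Y \<in> L0 P UNIV"
  shows "L0_le P (L0_ext P X) (L0_ext P Y) \<longleftrightarrow> (AE \<omega> in P. rep X \<omega> \<le> rep Y \<omega>)"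
proof -
  have "AE \<omega> in P. (rep (L0_ext P X) \<omega> \<le> rep (L0_ext P Y) \<omega>) = (rep X \<omega> \<le> rep Y \<omega>)"
    using rep_L0_ext[OF assms(1)] rep_L0_ext[OF assms(2)] by eventually_elim simp
  then show ?thesis unfolding L0_le_def by (rule eventually_subst)
qed

lemma L0_abs_closed: "K = \<real> \<or> K = UNIV \<Longrightarrow> X \<in> L0 P K \<Longrightarrow> L0_abs P X \<in> L0 P UNIV"
  unfolding L0_abs_def by (intro L0_class_in) (auto dest!: rep_rv rv_measurable)

lemma rep_L0_abs: "X \<in> L0 P K \<Longrightarrow> AE \<omega> in P. rep (L0_abs P X) \<omega> = cmod (rep X \<omega>)"
  unfolding L0_abs_def by (intro rep_class) (auto dest!: rep_rv rv_measurable)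

lemma L0_Re_closed: "X \<in> L0 P K \<Longrightarrow> L0_Re P X \<in> L0 P UNIV"
  unfolding L0_Re_def by (intro L0_class_in) (auto dest!: rep_rv rv_measurable)

lemma rep_L0_Re: "X \<in> L0 P K \<Longrightarrow> AE \<omega> in P. rep (L0_Re P X) \<omega> = Re (rep X \<omega>)"
  unfolding L0_Re_def by (intro rep_class) (auto dest!: rep_rv rv_measurable)

context random_locally_convex_module
begin

lemma seminorm_closed: "p \<in> \<P> \<Longrightarrow> e \<in> carrier E \<Longrightarrow> p e \<in> L0 P UNIV"
  using seminorms[of p] by (auto simp: L0_seminorm_def L0_nonneg_def)

lemma seminorm_measurable: "p \<in> \<P> \<Longrightarrow> e \<in> carrier E \<Longrightarrow> rep (p e) \<in> borel_measurable P"
  using rep_rv[OF seminorm_closed] by simp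

lemma seminorm_nonneg: "p \<in> \<P> \<Longrightarrow> e \<in> carrier E \<Longrightarrow> AE \<omega> in P. 0 \<le> rep (p e) \<omega>"
  using seminorms[of p] by (auto simp: L0_seminorm_def L0_nonneg_def)

lemma seminorm_triangle:
  assumes "p \<in> \<P>" "e \<in> carrier E" "e' \<in> carrier E"
  shows "AE \<omega> in P. rep (p (e \<oplus> e')) \<omega> \<le> rep (p e) \<omega> + rep (p e') \<omega>"
proof -
  have "L0_le P (p (e \<oplus> e')) (L0_plus P (p e) (p e'))"
    using seminorms[OF assms(1)] assms by (auto simp: L0_seminorm_def)
  moreover have "AE \<omega> in P. rep (L0_plus P (p e) (p e')) \<omega> = rep (p e) \<omega> + rep (p e') \<omega>"
    unfolding L0_plus_def using seminorm_measurable assms by (intro rep_class) auto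
  ultimately show ?thesis unfolding L0_le_def by eventually_elim simp
qed

lemma seminorm_smult:
  assumes "p \<in> \<P>" "c \<in> rv P K" "e \<in> carrier E"
  shows "AE \<omega> in P. rep (p (L0_class P K c \<odot> e)) \<omega> = cmod (c \<omega>) * rep (p e) \<omega>"
proof -
  let ?c = "L0_class P K c"
  have c: "?c \<in> L0 P K" using assms(2) by (rule L0_class_in)
  have "rep (L0_abs P ?c) \<in> borel_measurable P"
    using rep_rv[OF L0_abs_closed[OF scalar_field c]] by simp
  then have times: "AE \<omega> in P. rep (L0_times P (L0_abs P ?c) (p e)) \<omega> = rep (L0_abs P ?c) \<omega> * rep (p e) \<omega>"
    unfolding L0_times_def using seminorm_measurable assms by (intro rep_class) auto
  have eq: "p (?c \<odot> e) = L0_times P (L0_abs P ?c) (p e)"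
    using seminorms[OF assms(1)] assms c by (auto simp: L0_seminorm_def)
  show ?thesis unfolding eq using times rep_L0_abs[OF c] rep_class[OF assms(2)] by eventually_elim simp
qed

lemma seminorm_scal:
  assumes "p \<in> \<P>" "t \<in> borel_measurable P" "e \<in> carrier E"
  shows "AE \<omega> in P. rep (p (scal t e)) \<omega> = \<bar>t \<omega>\<bar> * rep (p e) \<omega>"
  using seminorm_smult[OF assms(1) rv_of_real[OF scalar_field assms(2)] assms(3)]
  by (simp add: scal_def)

lemma sup_seminorm_le_iff:
  assumes "\<Q> \<subseteq> \<P>" "e \<in> carrier E" "\<epsilon> \<in> L0 P UNIV"
  shows "L0_le P (sup_seminorm P \<Q> e) (L0_ext P \<epsilon>) \<longleftrightarrow> (\<forall>p\<in>\<Q>. AE \<omega> in P. rep (p e) \<omega> \<le> rep \<epsilon> \<omega>)"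
proof -
  have "(\<lambda>p. L0_ext P (p e)) ` \<Q> \<subseteq> L0 P UNIV"
    using assms seminorm_closed by (auto intro!: L0_ext_closed)
  then have "L0_le P (sup_seminorm P \<Q> e) (L0_ext P \<epsilon>) \<longleftrightarrow>
      (\<forall>p\<in>\<Q>. L0_le P (L0_ext P (p e)) (L0_ext P \<epsilon>))"
    unfolding sup_seminorm_def using L0_bar_Sup_le_iff[OF prob_space_axioms] L0_ext_closed[OF assms(3)]
    by simp
  also have "\<dots> \<longleftrightarrow> (\<forall>p\<in>\<Q>. AE \<omega> in P. rep (p e) \<omega> \<le> rep \<epsilon> \<omega>)"
    using assms seminorm_closed by (intro ball_cong refl L0_le_ext_iff) auto
  finally show ?thesis .
qed

text \<open>The supremum of the empty family is the class of minus infinity, not of zero, so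
  separation at the zero vector already forces a seminorm to exist. It is needed for the whole
  module to be open.\<close>

lemma seminorms_nonempty: "\<P> \<noteq> {}"
proof
  assume "\<P> = {}"
  moreover have "sup_seminorm P \<P> \<zero> = L0_class P UNIV (\<lambda>\<omega>. 0)" using separated[of \<zero>] by simp
  ultimately have *: "\<Squnion>\<^bsub>L0_bar P\<^esub> {} = L0_class P UNIV (\<lambda>\<omega>. 0)" by (simp add: sup_seminorm_def)
  have m: "(\<lambda>\<omega>. - \<infinity> :: ereal) \<in> rv P UNIV" "(\<lambda>\<omega>. 0 :: ereal) \<in> rv P UNIV" by auto
  have "L0_le P (\<Squnion>\<^bsub>L0_bar P\<^esub> {}) (L0_class P UNIV (\<lambda>\<omega>. - \<infinity>))"
    using L0_bar_Sup_le_iff[OF prob_space_axioms, of "{}"] L0_class_in[OF m(1)] by simp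
  then have "AE \<omega> in P. False"
    unfolding * L0_le_def using rep_class[OF m(1)] rep_class[OF m(2)] by eventually_elim simp
  then show False using AE_False by simp
qed

section \<open>The locally L0-convex topology and continuity of bounded homomorphisms\<close>

lemma Tc_nbhd_iff:
  assumes "\<Q> \<subseteq> \<P>" "\<epsilon> \<in> L0_pos P" "x \<in> carrier E"
  shows "y \<in> Tc_nbhd P E \<Q> \<epsilon> x \<longleftrightarrow>
    y \<in> carrier E \<and> (\<forall>p\<in>\<Q>. AE \<omega> in P. rep (p (y \<ominus> x)) \<omega> \<le> rep \<epsilon> \<omega>)"
proof -
  have "\<epsilon> \<in> L0 P UNIV" using assms(2) by (simp add: L0_pos_def)
  then show ?thesis unfolding Tc_nbhd_def
    using sup_seminorm_le_iff[OF assms(1), of "y \<ominus> x" \<epsilon>] assms(3) by blast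
qed

lemma class_pos:
  assumes "c \<in> borel_measurable P" "AE \<omega> in P. 0 < c \<omega>"
  shows "L0_class P UNIV c \<in> L0_pos P"
proof -
  have c: "c \<in> rv P UNIV" using assms by simp
  have "AE \<omega> in P. 0 < rep (L0_class P UNIV c) \<omega>"
    using rep_class[OF c] assms(2) by eventually_elim simp
  then show ?thesis using L0_class_in[OF c] by (simp add: L0_pos_def)
qed

lemma openin_Tc_iff: "openin (Tc P E \<P>) U \<longleftrightarrow> U \<subseteq> carrier E \<and>
    (\<forall>x\<in>U. \<exists>\<Q> \<epsilon>. \<Q> \<subseteq> \<P> \<and> finite \<Q> \<and> \<Q> \<noteq> {} \<and> \<epsilon> \<in> L0_pos P \<and> Tc_nbhd P E \<Q> \<epsilon> x \<subseteq> U)"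
  by (rule openin_Tc) (rule random_locally_convex_module_axioms)

lemma topspace_Tc: "topspace (Tc P E \<P>) = carrier E"
proof -
  obtain p where p: "p \<in> \<P>" using seminorms_nonempty by auto
  have "L0_class P UNIV (\<lambda>\<omega>. 1 :: real) \<in> L0_pos P" by (rule class_pos) auto
  then have "openin (Tc P E \<P>) (carrier E)" unfolding openin_Tc_iff using p
    by (intro conjI ballI exI[of _ "{p}"] exI[of _ "L0_class P UNIV (\<lambda>\<omega>. 1)"])
      (auto simp: Tc_nbhd_def)
  moreover have "openin (Tc P E \<P>) (topspace (Tc P E \<P>))" by simp
  then have "topspace (Tc P E \<P>) \<subseteq> carrier E" unfolding openin_Tc_iff by blast
  ultimately show ?thesis using openin_subset by blast
qed

text \<open>Makes the facts about \<open>Tc\<close> proved in this locale available for the codomain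
  of a functional as well.\<close>

lemma random_locally_convex_module_L0_alg: "random_locally_convex_module P K (L0_alg P K) {L0_abs P}"
proof -
  have smult: "a \<odot>\<^bsub>L0_alg P K\<^esub> b = a \<otimes>\<^bsub>L0_alg P K\<^esub> b" for a b by (simp add: L0_alg_def)
  have carr: "carrier (L0_alg P K) = L0 P K" by (simp add: L0_alg_def)
  show ?thesis
  proof (rule random_locally_convex_module.intro)
    show "prob_space P" by (rule prob_space_axioms)
    show "Module.module (L0_alg P K) (L0_alg P K)"
      by (rule moduleI) (auto simp: smult R.l_distr R.r_distr R.m_assoc intro: R.is_cring R.is_abelian_group)
    show "random_locally_convex_module_axioms P K (L0_alg P K) {L0_abs P}"
    proof
      show "K = \<real> \<or> K = UNIV" by (rule scalar_field)
      fix p assume "p \<in> {L0_abs P}"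
      then have p: "p = L0_abs P" by simp
      show "L0_seminorm P K (L0_alg P K) p" unfolding L0_seminorm_def carr p
      proof (intro conjI ballI)
        show "L0_abs P \<in> L0 P K \<rightarrow> L0_nonneg P"
        proof
          fix X assume X: "X \<in> L0 P K"
          have "AE \<omega> in P. 0 \<le> rep (L0_abs P X) \<omega>" using rep_L0_abs[OF X] by eventually_elim simp
          then show "L0_abs P X \<in> L0_nonneg P" using L0_abs_closed[OF scalar_field X] by (simp add: L0_nonneg_def)
        qed
        fix X Y assume XY: "X \<in> L0 P K" "Y \<in> L0 P K"
        note r = rep_rv[OF XY(1)] rep_rv[OF XY(2)]
        note a = L0_abs_closed[OF scalar_field XY(1)] L0_abs_closed[OF scalar_field XY(2)]
        have ra: "rep (L0_abs P X) \<in> borel_measurable P" "rep (L0_abs P Y) \<in> borel_measurable P"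
          using a[THEN rep_rv] by auto
        have times: "AE \<omega> in P. rep (L0_times P (L0_abs P X) (L0_abs P Y)) \<omega> =
            rep (L0_abs P X) \<omega> * rep (L0_abs P Y) \<omega>"
          unfolding L0_times_def using ra by (intro rep_class) auto
        have plus: "AE \<omega> in P. rep (L0_plus P (L0_abs P X) (L0_abs P Y)) \<omega> =
            rep (L0_abs P X) \<omega> + rep (L0_abs P Y) \<omega>"
          unfolding L0_plus_def using ra by (intro rep_class) auto
        have m: "AE \<omega> in P. rep (X \<odot>\<^bsub>L0_alg P K\<^esub> Y) \<omega> = rep X \<omega> * rep Y \<omega>"
          unfolding L0_alg_def using rep_class[OF rv_mult[OF scalar_field r]] by simp
        have s: "AE \<omega> in P. rep (X \<oplus>\<^bsub>L0_alg P K\<^esub> Y) \<omega> = rep X \<omega> + rep Y \<omega>"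
          unfolding L0_alg_def using rep_class[OF rv_add[OF scalar_field r]] by simp
        have mc: "X \<odot>\<^bsub>L0_alg P K\<^esub> Y \<in> L0 P K" and sc: "X \<oplus>\<^bsub>L0_alg P K\<^esub> Y \<in> L0 P K"
          using XY by (auto simp: smult simp flip: carr)
        show "L0_abs P (X \<odot>\<^bsub>L0_alg P K\<^esub> Y) = L0_times P (L0_abs P X) (L0_abs P Y)"
        proof (rule L0_eqI)
          show "L0_abs P (X \<odot>\<^bsub>L0_alg P K\<^esub> Y) \<in> L0 P UNIV" by (rule L0_abs_closed[OF scalar_field mc])
          show "L0_times P (L0_abs P X) (L0_abs P Y) \<in> L0 P UNIV"
            unfolding L0_times_def using ra by (intro L0_class_in) auto
          show "AE \<omega> in P. rep (L0_abs P (X \<odot>\<^bsub>L0_alg P K\<^esub> Y)) \<omega> = rep (L0_times P (L0_abs P X) (L0_abs P Y)) \<omega>"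
            using times m rep_L0_abs[OF mc] rep_L0_abs[OF XY(1)] rep_L0_abs[OF XY(2)]
            by eventually_elim (simp add: norm_mult)
        qed
        show "L0_le P (L0_abs P (X \<oplus>\<^bsub>L0_alg P K\<^esub> Y)) (L0_plus P (L0_abs P X) (L0_abs P Y))"
          unfolding L0_le_def
          using plus s rep_L0_abs[OF sc] rep_L0_abs[OF XY(1)] rep_L0_abs[OF XY(2)]
          by eventually_elim (simp add: norm_triangle_ineq)
      qed
    next
      fix X assume "X \<in> carrier (L0_alg P K)"
      then have X: "X \<in> L0 P K" by (simp add: carr)
      let ?a = "L0_ext P (L0_abs P X)" and ?z = "L0_class P UNIV (\<lambda>\<omega>. 0 :: ereal)"
      have aL: "L0_abs P X \<in> L0 P UNIV" by (rule L0_abs_closed[OF scalar_field X])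
      have a: "?a \<in> L0 P UNIV" by (rule L0_ext_closed[OF aL])
      note iff = L0_bar_Sup_le_iff[OF prob_space_axioms, of "{?a}"]
        and cl = L0_bar_Sup_closed[OF prob_space_axioms, of "{?a}"]
      have "L0_le P (\<Squnion>\<^bsub>L0_bar P\<^esub> {?a}) ?a" using iff[of ?a] a by (simp add: L0_le_def)
      moreover have "L0_le P ?a (\<Squnion>\<^bsub>L0_bar P\<^esub> {?a})"
        using iff[of "\<Squnion>\<^bsub>L0_bar P\<^esub> {?a}"] a cl by (simp add: L0_le_def)
      ultimately have "AE \<omega> in P. rep (\<Squnion>\<^bsub>L0_bar P\<^esub> {?a}) \<omega> = rep ?a \<omega>"
        unfolding L0_le_def by eventually_elim simp
      then have sup: "sup_seminorm P {L0_abs P} X = ?a"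
        unfolding sup_seminorm_def using cl a by (simp add: L0_eqI)
      have rz: "AE \<omega> in P. rep ?z \<omega> = 0" by (rule rep_class) simp
      have z: "?z \<in> L0 P UNIV" by (rule L0_class_in) simp
      have zA: "\<zero>\<^bsub>L0_alg P K\<^esub> \<in> L0 P K" using R.zero_closed by (simp only: carr)
      have "(\<lambda>\<omega>. 0) \<in> rv P K" using scalar_field by (auto simp: rv_iff)
      from rep_class[OF this] have rzA: "AE \<omega> in P. rep \<zero>\<^bsub>L0_alg P K\<^esub> \<omega> = 0"
        by (simp add: L0_alg_def)
      note ra = rep_L0_ext[OF aL] rep_L0_abs[OF X]
      show "sup_seminorm P {L0_abs P} X = ?z \<longleftrightarrow> X = \<zero>\<^bsub>L0_alg P K\<^esub>" unfolding sup
      proof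
        assume "?a = ?z"
        then have "AE \<omega> in P. rep ?a \<omega> = 0" using rz by simp
        then have "AE \<omega> in P. rep X \<omega> = rep \<zero>\<^bsub>L0_alg P K\<^esub> \<omega>" using ra rzA by eventually_elim simp
        then show "X = \<zero>\<^bsub>L0_alg P K\<^esub>" using X zA by (intro L0_eqI)
      next
        assume "X = \<zero>\<^bsub>L0_alg P K\<^esub>"
        then have "AE \<omega> in P. rep X \<omega> = 0" using rzA by simp
        then have "AE \<omega> in P. rep ?a \<omega> = rep ?z \<omega>" using ra rz by eventually_elim simp
        then show "?a = ?z" using a z by (intro L0_eqI)
      qed
    qed
  qed
qed

text \<open>By additivity it is enough to estimate \<open>f\<close> on differences. A neighbourhood
  controls each seminorm in \<open>\<Q>\<close> separately while the hypothesis involves their sum,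
  so the radius has to be divided by a constant.\<close>

lemma bounded_homomorphism_continuous:
  assumes f: "f \<in> carrier E \<rightarrow> L0 P K"
    and add: "\<And>x y. x \<in> carrier E \<Longrightarrow> y \<in> carrier E \<Longrightarrow> f (x \<oplus> y) = f x \<oplus>\<^bsub>L0_alg P K\<^esub> f y"
    and smult: "\<And>\<xi> x. \<xi> \<in> L0 P K \<Longrightarrow> x \<in> carrier E \<Longrightarrow> f (\<xi> \<odot> x) = \<xi> \<otimes>\<^bsub>L0_alg P K\<^esub> f x"
    and Q: "\<Q> \<subseteq> \<P>" "finite \<Q>" "\<Q> \<noteq> {}" and b: "0 < b"
    and bound: "\<And>x. x \<in> carrier E \<Longrightarrow> AE \<omega> in P. cmod (rep (f x) \<omega>) \<le> b * (\<Sum>p\<in>\<Q>. rep (p x) \<omega>)"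
  shows "f \<in> dual_c P K E \<P>"
proof -
  interpret A: random_locally_convex_module P K "L0_alg P K" "{L0_abs P}"
    by (rule random_locally_convex_module_L0_alg)
  have carr: "carrier (L0_alg P K) = L0 P K" by (simp add: L0_alg_def)
  have diff: "f (y \<ominus> x) = f y \<ominus>\<^bsub>L0_alg P K\<^esub> f x" if "x \<in> carrier E" "y \<in> carrier E" for x y
  proof -
    have "f y = f ((y \<ominus> x) \<oplus> x)" using that by (simp add: M.minus_eq M.a_assoc M.l_neg)
    also have "\<dots> = f (y \<ominus> x) \<oplus>\<^bsub>L0_alg P K\<^esub> f x" using that by (intro add) auto
    finally have *: "f y = f (y \<ominus> x) \<oplus>\<^bsub>L0_alg P K\<^esub> f x" .
    have "f x \<in> carrier (L0_alg P K)" "f (y \<ominus> x) \<in> carrier (L0_alg P K)"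
      using f that by (auto simp: carr)
    then show ?thesis unfolding * by (simp add: R.minus_eq R.a_assoc R.r_neg)
  qed
  have "openin (Tc P E \<P>) {x \<in> carrier E. f x \<in> U}" if U: "openin (Tc P (L0_alg P K) {L0_abs P}) U" for U
    unfolding openin_Tc_iff
  proof (intro conjI ballI)
    fix x assume "x \<in> {x \<in> carrier E. f x \<in> U}"
    then have x: "x \<in> carrier E" "f x \<in> U" by auto
    then obtain \<Q>' \<epsilon> where "\<Q>' \<subseteq> {L0_abs P}" "\<Q>' \<noteq> {}" and \<epsilon>: "\<epsilon> \<in> L0_pos P"
      and nb': "Tc_nbhd P (L0_alg P K) \<Q>' \<epsilon> (f x) \<subseteq> U"
      using U unfolding A.openin_Tc_iff by meson
    then have "\<Q>' = {L0_abs P}" by blast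
    with nb' have nb: "Tc_nbhd P (L0_alg P K) {L0_abs P} \<epsilon> (f x) \<subseteq> U" by simp
    have \<epsilon>': "\<epsilon> \<in> L0 P UNIV" "AE \<omega> in P. 0 < rep \<epsilon> \<omega>" using \<epsilon> by (auto simp: L0_pos_def)
    have [measurable]: "rep \<epsilon> \<in> borel_measurable P" using rep_rv[OF \<epsilon>'(1)] by simp
    \<comment> \<open>With each of the \<open>card \<Q>\<close> seminorms at most
      \<open>rep \<epsilon> \<omega> / n\<close>, the bound \<open>b\<close> times their sum comes
      out as exactly \<open>rep \<epsilon> \<omega>\<close>.\<close>
    define n where "n = b * real (card \<Q>)"
    have n: "0 < n" using Q b by (simp add: n_def card_gt_0_iff)
    let ?d = "\<lambda>\<omega>. rep \<epsilon> \<omega> / n"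
    let ?\<delta> = "L0_class P UNIV ?d"
    have r\<delta>: "AE \<omega> in P. rep ?\<delta> \<omega> = ?d \<omega>" by (rule rep_class) simp
    have \<delta>: "?\<delta> \<in> L0_pos P" using \<epsilon>'(2) n by (intro class_pos) auto
    have "Tc_nbhd P E \<Q> ?\<delta> x \<subseteq> {x \<in> carrier E. f x \<in> U}"
    proof
      fix y assume "y \<in> Tc_nbhd P E \<Q> ?\<delta> x"
      then have y: "y \<in> carrier E" and le: "\<And>p. p \<in> \<Q> \<Longrightarrow> AE \<omega> in P. rep (p (y \<ominus> x)) \<omega> \<le> rep ?\<delta> \<omega>"
        using Tc_nbhd_iff[OF Q(1) \<delta> x(1)] by auto
      have "AE \<omega> in P. \<forall>p\<in>\<Q>. rep (p (y \<ominus> x)) \<omega> \<le> rep ?\<delta> \<omega>"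
        using le Q(2) by (intro AE_finite_allI)
      then have "AE \<omega> in P. cmod (rep (f (y \<ominus> x)) \<omega>) \<le> rep \<epsilon> \<omega>"
        using bound[OF M.minus_closed[OF y x(1)]] r\<delta>
      proof eventually_elim
        case (elim \<omega>)
        have "(\<Sum>p\<in>\<Q>. rep (p (y \<ominus> x)) \<omega>) \<le> (\<Sum>p\<in>\<Q>. rep \<epsilon> \<omega> / n)"
          using elim by (intro sum_mono) auto
        then have "b * (\<Sum>p\<in>\<Q>. rep (p (y \<ominus> x)) \<omega>) \<le> b * (\<Sum>p\<in>\<Q>. rep \<epsilon> \<omega> / n)"
          using b by (intro mult_left_mono) auto
        also have "\<dots> = n * (rep \<epsilon> \<omega> / n)" by (simp add: n_def)
        also have "\<dots> = rep \<epsilon> \<omega>" using n by simp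
        finally show ?case using elim by simp
      qed
      moreover have "f (y \<ominus> x) \<in> L0 P K" using f x y by auto
      note rep_L0_abs[OF this]
      ultimately have "AE \<omega> in P. rep (L0_abs P (f y \<ominus>\<^bsub>L0_alg P K\<^esub> f x)) \<omega> \<le> rep \<epsilon> \<omega>"
        unfolding diff[OF x(1) y] by eventually_elim simp
      moreover have "f x \<in> carrier (L0_alg P K)" "f y \<in> carrier (L0_alg P K)"
        using f x y by (auto simp: carr)
      ultimately have "f y \<in> Tc_nbhd P (L0_alg P K) {L0_abs P} \<epsilon> (f x)"
        using A.Tc_nbhd_iff[of "{L0_abs P}" \<epsilon> "f x" "f y"] \<epsilon> by simp
      then show "y \<in> {x \<in> carrier E. f x \<in> U}" using nb y by auto
    qed
    then show "\<exists>\<Q> \<epsilon>. \<Q> \<subseteq> \<P> \<and> finite \<Q> \<and> \<Q> \<noteq> {} \<and> \<epsilon> \<in> L0_pos P \<and>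
        Tc_nbhd P E \<Q> \<epsilon> x \<subseteq> {x \<in> carrier E. f x \<in> U}"
      using Q \<delta> by blast
  qed auto
  then have "continuous_map (Tc P E \<P>) (Tc P (L0_alg P K) {L0_abs P}) f"
    using f by (simp add: continuous_map_def topspace_Tc A.topspace_Tc carr)
  then show ?thesis using f add smult by (auto simp: dual_c_def)
qed

end

section \<open>Real parts and complexification\<close>

context random_locally_convex_module
begin

text \<open>Reduces a complex scalar to two real ones and multiplication by \<i>, so that a map
  known to be homogeneous for \<open>scal\<close> can be evaluated on it.\<close>

lemma smult_imaginary:
  assumes K: "K = UNIV" and \<xi>: "\<xi> \<in> L0 P K" and e: "e \<in> carrier E"
  shows "\<xi> \<odot> e = scal (\<lambda>\<omega>. Re (rep \<xi> \<omega>)) e \<oplus>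
    scal (\<lambda>\<omega>. Im (rep \<xi> \<omega>)) (L0_class P K (\<lambda>\<omega>. \<i>) \<odot> e)"
proof -
  let ?a = "\<lambda>\<omega>. complex_of_real (Re (rep \<xi> \<omega>))" and ?b = "\<lambda>\<omega>. complex_of_real (Im (rep \<xi> \<omega>))"
  have [measurable]: "rep \<xi> \<in> borel_measurable P" using rep_rv[OF \<xi>] by (rule rv_measurable)
  have rv: "?a \<in> rv P K" "?b \<in> rv P K" "(\<lambda>\<omega>. \<i>) \<in> rv P K" "(\<lambda>\<omega>. ?b \<omega> * \<i>) \<in> rv P K"
    by (simp_all add: K)
  have "\<xi> = L0_class P K (rep \<xi>)" by (simp add: class_rep[OF \<xi>])
  also have "rep \<xi> = (\<lambda>\<omega>. ?a \<omega> + ?b \<omega> * \<i>)"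
    by (simp add: complex_eq_iff fun_eq_iff)
  also have "L0_class P K \<dots> = L0_class P K ?a \<oplus>\<^bsub>L0_alg P K\<^esub> L0_class P K ?b \<otimes>\<^bsub>L0_alg P K\<^esub> L0_class P K (\<lambda>\<omega>. \<i>)"
    using rv by (simp add: L0_class_mult[OF scalar_field] L0_class_add[OF scalar_field])
  finally have eq: "\<xi> = L0_class P K ?a \<oplus>\<^bsub>L0_alg P K\<^esub>
    L0_class P K ?b \<otimes>\<^bsub>L0_alg P K\<^esub> L0_class P K (\<lambda>\<omega>. \<i>)" .
  show ?thesis
    using arg_cong[OF eq, of "\<lambda>z. z \<odot> e"] e rv[THEN class_carrier] by (simp add: scal_def smult_l_distr smult_assoc1)
qed

lemma smult_imaginary_imaginary:
  assumes K: "K = UNIV" and e: "e \<in> carrier E"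
  shows "L0_class P K (\<lambda>\<omega>. \<i>) \<odot> (L0_class P K (\<lambda>\<omega>. \<i>) \<odot> e) = \<ominus> e"
proof -
  have rv: "(\<lambda>\<omega>. \<i>) \<in> rv P K" by (simp add: K)
  have "L0_class P K (\<lambda>\<omega>. \<i>) \<otimes>\<^bsub>L0_alg P K\<^esub> L0_class P K (\<lambda>\<omega>. \<i>) = L0_class P K (\<lambda>\<omega>. complex_of_real (- 1))"
    using L0_class_mult[OF scalar_field rv rv] by simp
  then have "L0_class P K (\<lambda>\<omega>. \<i>) \<odot> (L0_class P K (\<lambda>\<omega>. \<i>) \<odot> e) = scal (\<lambda>\<omega>. - 1) e"
    using smult_assoc1[OF class_carrier[OF rv] class_carrier[OF rv] e] by (simp add: scal_def)
  then show ?thesis using scal_minus_left[of "\<lambda>\<omega>. 1" e] e by (simp add: scal_one)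
qed

text \<open>Complexification: a complex-linear \<open>f\<close> with real part \<open>F\<close> must
  have imaginary part \<open>- F (\<i> e)\<close>, because the imaginary part of a number is minus
  the real part of \<i> times it. Over the reals \<open>F\<close> itself is used.\<close>

lemma real_functional_is_Re:
  assumes F: "\<And>e. e \<in> carrier E \<Longrightarrow> F e \<in> borel_measurable P"
    and add: "\<And>e e'. e \<in> carrier E \<Longrightarrow> e' \<in> carrier E \<Longrightarrow> AE \<omega> in P. F (e \<oplus> e') \<omega> = F e \<omega> + F e' \<omega>"
    and hom: "\<And>t e. t \<in> borel_measurable P \<Longrightarrow> e \<in> carrier E \<Longrightarrow> AE \<omega> in P. F (scal t e) \<omega> = t \<omega> * F e \<omega>"
    and bound: "\<And>e. e \<in> carrier E \<Longrightarrow> AE \<omega> in P. \<bar>F e \<omega>\<bar> \<le> (\<Sum>p\<in>\<Q>. rep (p e) \<omega>)"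
    and Q: "\<Q> \<subseteq> \<P>" "finite \<Q>" "\<Q> \<noteq> {}"
  obtains f where "f \<in> dual_c P K E \<P>" "\<And>e. e \<in> carrier E \<Longrightarrow> AE \<omega> in P. Re (rep (f e) \<omega>) = F e \<omega>"
proof -
  define j where "j = (\<lambda>e. L0_class P K (\<lambda>\<omega>. \<i>) \<odot> e)"
  define G where "G = (\<lambda>e \<omega>. if K = UNIV then Complex (F e \<omega>) (- F (j e) \<omega>) else complex_of_real (F e \<omega>))"
  define f where "f = (\<lambda>e. L0_class P K (G e))"
  have j: "j e \<in> carrier E" if "K = UNIV" "e \<in> carrier E" for e
    unfolding j_def using that by (intro smult_closed class_carrier) auto
  have G: "G e \<in> rv P K" if e: "e \<in> carrier E" for e
  proof (cases "K = UNIV")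
    case True
    note [measurable] = F[OF e] F[OF j[OF True e]]
    have "(\<lambda>\<omega>. complex_of_real (F e \<omega>) + \<i> * complex_of_real (- F (j e) \<omega>)) \<in> borel_measurable P"
      by measurable
    then show ?thesis using True by (simp add: G_def Complex_eq)
  next
    case False
    then show ?thesis using rv_of_real[OF scalar_field F[OF e]] by (simp add: G_def)
  qed
  have Gadd: "AE \<omega> in P. G (e \<oplus> e') \<omega> = G e \<omega> + G e' \<omega>" if e: "e \<in> carrier E" "e' \<in> carrier E" for e e'
  proof (cases "K = UNIV")
    case True
    have "j (e \<oplus> e') = j e \<oplus> j e'" unfolding j_def using True e by (intro smult_r_distr class_carrier) auto
    then have "AE \<omega> in P. F (j (e \<oplus> e')) \<omega> = F (j e) \<omega> + F (j e') \<omega>"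
      using add[OF j[OF True e(1)] j[OF True e(2)]] by simp
    then show ?thesis using add[OF e] by eventually_elim (simp add: G_def True complex_eq_iff)
  next
    case False
    show ?thesis using add[OF e] by eventually_elim (simp add: G_def False)
  qed
  have Ghom: "AE \<omega> in P. G (\<xi> \<odot> e) \<omega> = rep \<xi> \<omega> * G e \<omega>" if \<xi>: "\<xi> \<in> L0 P K" and e: "e \<in> carrier E" for \<xi> e
  proof (cases "K = UNIV")
    case True
    let ?a = "\<lambda>\<omega>. Re (rep \<xi> \<omega>)" and ?b = "\<lambda>\<omega>. Im (rep \<xi> \<omega>)"
    have [measurable]: "rep \<xi> \<in> borel_measurable P" using rep_rv[OF \<xi>] by (rule rv_measurable)
    have je: "j e \<in> carrier E" by (rule j[OF True e])
    have 1: "\<xi> \<odot> e = scal ?a e \<oplus> scal ?b (j e)"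
      unfolding j_def by (rule smult_imaginary[OF True \<xi> e])
    have iC: "L0_class P K (\<lambda>\<omega>. \<i>) \<in> carrier (L0_alg P K)" by (rule class_carrier) (simp add: True)
    have \<xi>C: "\<xi> \<in> carrier (L0_alg P K)" using \<xi> by (simp add: L0_alg_def)
    \<comment> \<open>Scalars commute, so \<i> moves past \<open>\<xi>\<close>; the square of
      \<open>j\<close> being negation then produces the minus sign of complex
      multiplication.\<close>
    have "j (\<xi> \<odot> e) = \<xi> \<odot> j e"
      unfolding j_def 
      using smult_assoc1[OF iC \<xi>C e] smult_assoc1[OF \<xi>C iC e] R.m_comm[OF iC \<xi>C] by simp
    also have "\<dots> = scal ?a (j e) \<oplus> scal ?b (j (j e))"
      unfolding j_def by (rule smult_imaginary[OF True \<xi>]) (use je in \<open>simp add: j_def\<close>)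
    also have "j (j e) = \<ominus> e" unfolding j_def by (rule smult_imaginary_imaginary[OF True e])
    also have "scal ?b (\<ominus> e) = scal (\<lambda>\<omega>. - ?b \<omega>) e"
      using e by (simp add: scal_minus_left scal_minus_right)
    finally have 2: "j (\<xi> \<odot> e) = scal ?a (j e) \<oplus> scal (\<lambda>\<omega>. - ?b \<omega>) e" .
    have m: "?a \<in> borel_measurable P" "?b \<in> borel_measurable P" "(\<lambda>\<omega>. - ?b \<omega>) \<in> borel_measurable P"
      by measurable
    show ?thesis
      using add[OF scal_closed[OF m(1) e] scal_closed[OF m(2) je]] hom[OF m(1) e] hom[OF m(2) je]
        add[OF scal_closed[OF m(1) je] scal_closed[OF m(3) e]] hom[OF m(1) je] hom[OF m(3) e]
    proof eventually_elim
      case (elim \<omega>)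
      have "F (\<xi> \<odot> e) \<omega> = ?a \<omega> * F e \<omega> + ?b \<omega> * F (j e) \<omega>" using elim unfolding 1 by simp
      moreover have "F (j (\<xi> \<odot> e)) \<omega> = ?a \<omega> * F (j e) \<omega> - ?b \<omega> * F e \<omega>" using elim unfolding 2 by simp
      ultimately show ?case by (simp add: G_def True complex_eq_iff)
    qed
  next
    case False
    then have K: "K = \<real>" using scalar_field by blast
    let ?a = "\<lambda>\<omega>. Re (rep \<xi> \<omega>)"
    have rv: "rep \<xi> \<in> rv P K" by (rule rep_rv[OF \<xi>])
    then have [measurable]: "rep \<xi> \<in> borel_measurable P" by (rule rv_measurable)
    \<comment> \<open>A representative takes values in \<open>K\<close> only on
      \<open>space P\<close>, hence the restriction.\<close>
    have a: "complex_of_real (?a \<omega>) = rep \<xi> \<omega>" if "\<omega> \<in> space P" for \<omega>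
      using rv that by (auto simp: rv_iff K elim!: Reals_cases)
    have m: "?a \<in> borel_measurable P" by measurable
    have "L0_class P K (\<lambda>\<omega>. complex_of_real (?a \<omega>)) = L0_class P K (rep \<xi>)"
      using a by (intro class_eq rv rv_of_real[OF scalar_field m] AE_I2)
    then have 1: "\<xi> \<odot> e = scal ?a e" by (simp add: scal_def class_rep[OF \<xi>])
    have "AE \<omega> in P. complex_of_real (?a \<omega>) = rep \<xi> \<omega>" using a by (intro AE_I2)
    with hom[OF m e] show ?thesis unfolding 1
    proof eventually_elim
      case (elim \<omega>)
      then show ?case using False by (simp add: G_def)
    qed
  qed
  have carr: "f e \<in> L0 P K" if "e \<in> carrier E" for e
    unfolding f_def using G[OF that] by (rule L0_class_in)
  have rep_f: "AE \<omega> in P. rep (f e) \<omega> = G e \<omega>" if "e \<in> carrier E" for e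
    unfolding f_def using G[OF that] by (rule rep_class)
  have "f \<in> dual_c P K E \<P>"
  \<comment> \<open>The factor 2 comes from estimating the modulus by the sum of the absolute real
    and imaginary parts, each at most the sum of the seminorms.\<close>
  proof (rule bounded_homomorphism_continuous[OF _ _ _ Q, of _ 2])
    show "f \<in> carrier E \<rightarrow> L0 P K" using carr by auto
    show "f (e \<oplus> e') = f e \<oplus>\<^bsub>L0_alg P K\<^esub> f e'" if e: "e \<in> carrier E" "e' \<in> carrier E" for e e'
    proof -
      have "f (e \<oplus> e') = L0_class P K (\<lambda>\<omega>. G e \<omega> + G e' \<omega>)"
        unfolding f_def using Gadd[OF e] G e by (intro class_eq rv_add[OF scalar_field]) auto
      then show ?thesis unfolding f_def using L0_class_add[OF scalar_field G[OF e(1)] G[OF e(2)]] by simp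
    qed
    show "f (\<xi> \<odot> e) = \<xi> \<otimes>\<^bsub>L0_alg P K\<^esub> f e" if \<xi>: "\<xi> \<in> L0 P K" and e: "e \<in> carrier E" for \<xi> e
    proof -
      have "\<xi> \<odot> e \<in> carrier E" using \<xi> e by (intro smult_closed) (auto simp: L0_alg_def)
      then have "f (\<xi> \<odot> e) = L0_class P K (\<lambda>\<omega>. rep \<xi> \<omega> * G e \<omega>)"
        unfolding f_def using Ghom[OF \<xi> e] G e rep_rv[OF \<xi>]
        by (intro class_eq rv_mult[OF scalar_field]) auto
      then show ?thesis unfolding f_def
        using L0_class_mult[OF scalar_field rep_rv[OF \<xi>] G[OF e]] by (simp add: class_rep[OF \<xi>])
    qed
    fix e assume e: "e \<in> carrier E"
    have "AE \<omega> in P. \<forall>p\<in>\<Q>. 0 \<le> rep (p e) \<omega>"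
      using Q e seminorm_nonneg by (intro AE_finite_allI) auto
    then have pos: "AE \<omega> in P. 0 \<le> (\<Sum>p\<in>\<Q>. rep (p e) \<omega>)" by eventually_elim (simp add: sum_nonneg)
    show "AE \<omega> in P. cmod (rep (f e) \<omega>) \<le> 2 * (\<Sum>p\<in>\<Q>. rep (p e) \<omega>)"
    proof (cases "K = UNIV")
      case True
      \<comment> \<open>Since \<i> has modulus one, no seminorm distinguishes \<open>j e\<close>
        from \<open>e\<close>.\<close>
      have "AE \<omega> in P. rep (p (j e)) \<omega> = rep (p e) \<omega>" if "p \<in> \<Q>" for p
        using seminorm_smult[of p "\<lambda>\<omega>. \<i>" e] that Q e True by (auto simp: j_def)
      then have "AE \<omega> in P. \<forall>p\<in>\<Q>. rep (p (j e)) \<omega> = rep (p e) \<omega>"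
        using Q by (intro AE_finite_allI) auto
      then show ?thesis using rep_f[OF e] bound[OF e] bound[OF j[OF True e]]
      proof eventually_elim
        case (elim \<omega>)
        have "cmod (rep (f e) \<omega>) \<le> \<bar>F e \<omega>\<bar> + \<bar>F (j e) \<omega>\<bar>"
          using cmod_le[of "rep (f e) \<omega>"] elim by (simp add: G_def True)
        also have "\<bar>F (j e) \<omega>\<bar> \<le> (\<Sum>p\<in>\<Q>. rep (p e) \<omega>)" using elim by simp
        finally show ?case using elim by simp
      qed
    next
      case False
      show ?thesis using rep_f[OF e] bound[OF e] pos by eventually_elim (simp add: G_def False)
    qed
  qed simp
  moreover have "AE \<omega> in P. Re (rep (f e) \<omega>) = F e \<omega>" if "e \<in> carrier E" for e
    using rep_f[OF that] by eventually_elim (simp add: G_def)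
  ultimately show thesis using that by blast
qed

end

section \<open>Separation\<close>

context L0_sublinear
begin

text \<open>A point of \<open>D\<close> with the demand \<open>h\<close> is consistent because
  \<open>h \<le> N d\<close>, and convexity of \<open>D\<close> is exactly what makes such demands,
  together with the bounds \<open>- N e\<close>, form a cone. \<open>cone_extension\<close> does the
  rest.\<close>

theorem convex_separation:
  assumes D: "D \<subseteq> carrier E" "D \<noteq> {}"
    and convex: "\<And>d d' l. d \<in> D \<Longrightarrow> d' \<in> D \<Longrightarrow> l \<in> borel_measurable P \<Longrightarrow> (\<And>\<omega>. 0 \<le> l \<omega> \<and> l \<omega> \<le> 1) \<Longrightarrow>
      scal l d \<oplus> scal (\<lambda>\<omega>. 1 - l \<omega>) d' \<in> D"
    and h [measurable]: "h \<in> borel_measurable P"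
    and le: "\<And>d. d \<in> D \<Longrightarrow> AE \<omega> in P. h \<omega> \<le> N d \<omega>"
  obtains F where
    "\<And>e. e \<in> carrier E \<Longrightarrow> F e \<in> borel_measurable P"
    "\<And>e e'. e \<in> carrier E \<Longrightarrow> e' \<in> carrier E \<Longrightarrow> AE \<omega> in P. F (e \<oplus> e') \<omega> = F e \<omega> + F e' \<omega>"
    "\<And>t e. t \<in> borel_measurable P \<Longrightarrow> e \<in> carrier E \<Longrightarrow> AE \<omega> in P. F (scal t e) \<omega> = t \<omega> * F e \<omega>"
    "\<And>e. e \<in> carrier E \<Longrightarrow> AE \<omega> in P. \<bar>F e \<omega>\<bar> \<le> N e \<omega>"
    "\<And>d. d \<in> D \<Longrightarrow> AE \<omega> in P. h \<omega> \<le> F d \<omega>"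
proof -
  define C where "C = {(e \<oplus> scal t d, s) |e t d s. e \<in> carrier E \<and> d \<in> D \<and> t \<in> borel_measurable P \<and>
    (\<forall>\<omega>. 0 \<le> t \<omega>) \<and> s \<in> borel_measurable P \<and> (AE \<omega> in P. s \<omega> \<le> t \<omega> * h \<omega> - N e \<omega>)}"
  have CI: "(c, s) \<in> C" if "c = e \<oplus> scal t d" "e \<in> carrier E" "d \<in> D" "t \<in> borel_measurable P"
    "\<And>\<omega>. 0 \<le> t \<omega>" "s \<in> borel_measurable P" "AE \<omega> in P. s \<omega> \<le> t \<omega> * h \<omega> - N e \<omega>" for c e t d s
    unfolding C_def using that by blast
  obtain d\<^sub>0 where d\<^sub>0: "d\<^sub>0 \<in> D" using D by blast
  have "is_cone C" unfolding is_cone_def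
  proof (intro conjI[of "\<forall>c s d r. _ c s d r"] conjI[of "Ball _ _"] conjI[of "All _"] allI impI ballI)
    fix e assume e: "e \<in> carrier E"
    show "(e, \<lambda>\<omega>. - N e \<omega>) \<in> C"
      using e d\<^sub>0 D N_measurable[OF e] by (intro CI[of _ e "\<lambda>\<omega>. 0" d\<^sub>0]) (auto simp: scal_zero)
  next
    fix c s assume "(c, s) \<in> C"
    then obtain e t d where c: "c = e \<oplus> scal t d" and e: "e \<in> carrier E" and d: "d \<in> D"
      and t [measurable]: "t \<in> borel_measurable P" and pos: "\<And>\<omega>. 0 \<le> t \<omega>"
      and s [measurable]: "s \<in> borel_measurable P" and sle: "AE \<omega> in P. s \<omega> \<le> t \<omega> * h \<omega> - N e \<omega>"
      unfolding C_def by blast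
    have dE: "d \<in> carrier E" using d D by blast
    have cE: "c \<in> carrier E" using c e dE by simp
    \<comment> \<open>Consistency with \<open>N\<close>: writing \<open>t d\<close> as
      \<open>c\<close> minus \<open>e\<close> gives
      \<open>t * h \<le> N (t d) \<le> N c + N e\<close>.\<close>
    have td: "scal t d = c \<oplus> \<ominus> e" using e dE by (simp add: c M.a_ac M.r_neg2 M.r_neg1)
    have "AE \<omega> in P. N (scal t d) \<omega> \<le> N c \<omega> + N (\<ominus> e) \<omega>"
      unfolding td using cE e by (intro N_add) auto
    then have "AE \<omega> in P. s \<omega> \<le> N c \<omega>"
      using sle N_minus[OF e] N_scal[OF t dE] le[OF d]
    proof eventually_elim
      case (elim \<omega>)
      have "t \<omega> * h \<omega> \<le> t \<omega> * N d \<omega>" using elim pos by (intro mult_left_mono)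
      then show ?case using elim pos[of \<omega>] by simp
    qed
    then show "c \<in> carrier E \<and> s \<in> borel_measurable P \<and> (AE \<omega> in P. s \<omega> \<le> N c \<omega>)"
      using cE s by blast
    fix u assume u [measurable]: "u \<in> borel_measurable P" and upos: "\<forall>\<omega>. 0 \<le> (u \<omega> :: real)"
    show "(scal u c, \<lambda>\<omega>. u \<omega> * s \<omega>) \<in> C"
    proof (rule CI[of _ "scal u e" "\<lambda>\<omega>. u \<omega> * t \<omega>" d])
      show "scal u c = scal u e \<oplus> scal (\<lambda>\<omega>. u \<omega> * t \<omega>) d"
        using e dE by (simp add: c scal_add_right scal_mult)
      show "AE \<omega> in P. u \<omega> * s \<omega> \<le> u \<omega> * t \<omega> * h \<omega> - N (scal u e) \<omega>"
        using sle N_scal[OF u e]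
      proof eventually_elim
        case (elim \<omega>)
        have "u \<omega> * s \<omega> \<le> u \<omega> * (t \<omega> * h \<omega> - N e \<omega>)" using elim upos by (intro mult_left_mono) auto
        then show ?case using elim upos by (simp add: algebra_simps)
      qed
    qed (use upos pos e d in auto)
  next
    fix c s c' s' assume "(c, s) \<in> C" "(c', s') \<in> C"
    then obtain e t d e' t' d' where c: "c = e \<oplus> scal t d" "c' = e' \<oplus> scal t' d'"
      and e: "e \<in> carrier E" "e' \<in> carrier E" and d: "d \<in> D" "d' \<in> D"
      and t [measurable]: "t \<in> borel_measurable P" "t' \<in> borel_measurable P"
      and pos: "\<And>\<omega>. 0 \<le> t \<omega>" "\<And>\<omega>. 0 \<le> t' \<omega>"
      and s [measurable]: "s \<in> borel_measurable P" "s' \<in> borel_measurable P"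
      and sle: "AE \<omega> in P. s \<omega> \<le> t \<omega> * h \<omega> - N e \<omega>" "AE \<omega> in P. s' \<omega> \<le> t' \<omega> * h \<omega> - N e' \<omega>"
      unfolding C_def by blast
    have dE: "d \<in> carrier E" "d' \<in> carrier E" using d D by auto
    \<comment> \<open>Two multiples merge into one: \<open>t d\<close> plus \<open>t' d'\<close> is
      the total weight times a convex combination with coefficient \<open>t / (t + t')\<close>.
      Where the total weight vanishes the coefficient is irrelevant and set to 0.\<close>
    let ?t = "\<lambda>\<omega>. t \<omega> + t' \<omega>" and ?l = "\<lambda>\<omega>. if t \<omega> + t' \<omega> = 0 then 0 else t \<omega> / (t \<omega> + t' \<omega>)"
    have l [measurable]: "?l \<in> borel_measurable P" by measurable
    have l01: "0 \<le> ?l \<omega> \<and> ?l \<omega> \<le> 1" for \<omega>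
      using pos[of \<omega>] by (auto simp: divide_le_eq_1)
    have t0: "t \<omega> = 0 \<and> t' \<omega> = 0" if "t \<omega> + t' \<omega> = 0" for \<omega>
      using pos[of \<omega>] that by linarith
    let ?d = "scal ?l d \<oplus> scal (\<lambda>\<omega>. 1 - ?l \<omega>) d'"
    have tl: "?t \<omega> * ?l \<omega> = t \<omega>" for \<omega> using t0[of \<omega>] by (cases "?t \<omega> = 0") simp_all
    have tl': "?t \<omega> * (1 - ?l \<omega>) = t' \<omega>" for \<omega>
      unfolding right_diff_distrib tl by simp
    have "scal (\<lambda>\<omega>. ?t \<omega> * ?l \<omega>) d = scal t d" by (simp only: tl)
    moreover have "scal (\<lambda>\<omega>. ?t \<omega> * (1 - ?l \<omega>)) d' = scal t' d'" by (simp only: tl')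
    ultimately have "scal ?t ?d = scal t d \<oplus> scal t' d'"
      using dE by (simp only: scal_add_right scal_mult[symmetric] scal_closed borel_measurable_add t l
          borel_measurable_diff borel_measurable_const)
    then have cc: "c \<oplus> c' = (e \<oplus> e') \<oplus> scal ?t ?d"
      using e dE t by (simp add: c M.a_ac)
    show "(c \<oplus> c', \<lambda>\<omega>. s \<omega> + s' \<omega>) \<in> C"
    proof (rule CI[OF cc])
      show "?d \<in> D" by (rule convex[OF d l l01])
      show "AE \<omega> in P. s \<omega> + s' \<omega> \<le> (t \<omega> + t' \<omega>) * h \<omega> - N (e \<oplus> e') \<omega>"
        using sle N_add[OF e] by eventually_elim (simp add: algebra_simps)
    qed (use pos e in \<open>auto intro: add_nonneg_nonneg\<close>)
  qed
  then obtain F where F: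
    "\<And>e. e \<in> carrier E \<Longrightarrow> F e \<in> borel_measurable P"
    "\<And>e e'. e \<in> carrier E \<Longrightarrow> e' \<in> carrier E \<Longrightarrow> AE \<omega> in P. F (e \<oplus> e') \<omega> = F e \<omega> + F e' \<omega>"
    "\<And>t e. t \<in> borel_measurable P \<Longrightarrow> e \<in> carrier E \<Longrightarrow> AE \<omega> in P. F (scal t e) \<omega> = t \<omega> * F e \<omega>"
    "\<And>e. e \<in> carrier E \<Longrightarrow> AE \<omega> in P. \<bar>F e \<omega>\<bar> \<le> N e \<omega>"
    and FC: "\<And>c s. (c, s) \<in> C \<Longrightarrow> AE \<omega> in P. s \<omega> \<le> F c \<omega>"
    using cone_extension[of C] by blast
  have "AE \<omega> in P. h \<omega> \<le> F d \<omega>" if d: "d \<in> D" for d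
  proof -
    \<comment> \<open>The representation is the zero vector plus one times \<open>d\<close>.\<close>
    have "(d, h) \<in> C"
      using D d N_zero by (intro CI[of _ \<zero> "\<lambda>\<omega>. 1" d]) (auto simp: scal_one elim: eventually_mono)
    then show ?thesis by (rule FC)
  qed
  with F show thesis using that by blast
qed

end

section \<open>Convexity for functions as coefficients, and the gap between a point and a closed
  set\<close>

context random_locally_convex_module
begin

lemma L0_indicator_smult: "L0_indicator P K A \<odot> e = scal (indicator A) e"
proof -
  have "(\<lambda>\<omega>. complex_of_real (indicator A \<omega>)) = indicator A"
    by (auto simp: fun_eq_iff indicator_def)
  then show ?thesis by (simp add: scal_def L0_indicator_def)
qed

lemma L0_convex_scal:
  assumes M: "L0_convex P K E M" "y \<in> M" "y' \<in> M"
    and l [measurable]: "l \<in> borel_measurable P" and l01: "\<And>\<omega>. 0 \<le> l \<omega> \<and> l \<omega> \<le> 1"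
  shows "scal l y \<oplus> scal (\<lambda>\<omega>. 1 - l \<omega>) y' \<in> M"
proof -
  let ?\<xi> = "L0_class P UNIV l" and ?c = "L0_class P K (\<lambda>\<omega>. complex_of_real (l \<omega>))"
    and ?d = "L0_class P K (\<lambda>\<omega>. complex_of_real (1 - l \<omega>))"
  have rv: "l \<in> rv P UNIV" "(\<lambda>\<omega>. 1 :: real) \<in> rv P UNIV" by auto
  have m: "(\<lambda>\<omega>. 1 - l \<omega>) \<in> borel_measurable P" by measurable
  have \<xi>: "?\<xi> \<in> L0 P UNIV" by (rule L0_class_in[OF rv(1)])
  have r: "AE \<omega> in P. rep ?\<xi> \<omega> = l \<omega>" by (rule rep_class[OF rv(1)])
  have "AE \<omega> in P. 0 \<le> rep ?\<xi> \<omega>" using r by eventually_elim (simp add: l01)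
  then have nonneg: "?\<xi> \<in> L0_nonneg P" using \<xi> by (simp add: L0_nonneg_def)
  have le: "L0_le P ?\<xi> (L0_class P UNIV (\<lambda>\<omega>. 1))"
    unfolding L0_le_def using r rep_class[OF rv(2)] by eventually_elim (simp add: l01)
  have c: "L0_scalar P K ?\<xi> = ?c" unfolding L0_scalar_def
  proof (rule class_eq)
    show "(\<lambda>\<omega>. complex_of_real (rep ?\<xi> \<omega>)) \<in> rv P K"
      using rep_rv[OF \<xi>] by (intro rv_of_real[OF scalar_field]) simp
    show "AE \<omega> in P. complex_of_real (rep ?\<xi> \<omega>) = complex_of_real (l \<omega>)"
      using r by eventually_elim simp
  qed (rule rv_of_real[OF scalar_field l])
  have cd: "?c \<in> carrier (L0_alg P K)" "?d \<in> carrier (L0_alg P K)"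
    by (intro class_of_real_carrier l m)+
  have "?d \<oplus>\<^bsub>L0_alg P K\<^esub> ?c = \<one>\<^bsub>L0_alg P K\<^esub>"
    using L0_class_add[OF scalar_field rv_of_real[OF scalar_field m] rv_of_real[OF scalar_field l]]
    by (simp add: L0_alg_def)
  then have "\<one>\<^bsub>L0_alg P K\<^esub> \<ominus>\<^bsub>L0_alg P K\<^esub> ?c = ?d \<oplus>\<^bsub>L0_alg P K\<^esub> ?c \<ominus>\<^bsub>L0_alg P K\<^esub> ?c" by simp
  also have "\<dots> = ?d" using cd by (simp add: R.minus_eq R.a_assoc R.r_neg)
  finally have d: "\<one>\<^bsub>L0_alg P K\<^esub> \<ominus>\<^bsub>L0_alg P K\<^esub> ?c = ?d" .
  have "(L0_scalar P K ?\<xi> \<odot> y) \<oplus> ((\<one>\<^bsub>L0_alg P K\<^esub> \<ominus>\<^bsub>L0_alg P K\<^esub> L0_scalar P K ?\<xi>) \<odot> y') \<in> M"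
    using M nonneg le unfolding L0_convex_def by blast
  then show ?thesis unfolding c d scal_def .
qed

text \<open>The set \<open>B\<close> is the complement of the essential union of the events on which some \<open>y \<in> M\<close> lies
  in the neighbourhood of \<open>x\<close> that avoids \<open>M\<close>. It is not null: otherwise concatenating countably
  many such \<open>y\<close> would give a point of \<open>M\<close> in that neighbourhood.\<close>

lemma closed_concatenation_gap:
  assumes M: "M \<subseteq> carrier E" "M \<noteq> {}" and closed: "closedin (Tc P E \<P>) M"
    and conc: "countable_concatenation P K E M" and x: "x \<in> carrier E" "x \<notin> M"
  obtains \<Q> \<epsilon> B where "\<Q> \<subseteq> \<P>" "finite \<Q>" "\<Q> \<noteq> {}" "\<epsilon> \<in> borel_measurable P" "AE \<omega> in P. 0 < \<epsilon> \<omega>"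
    "B \<in> sets P" "measure P B > 0"
    "\<And>y. y \<in> M \<Longrightarrow> AE \<omega> in P. \<omega> \<in> B \<longrightarrow> \<epsilon> \<omega> \<le> (\<Sum>p\<in>\<Q>. rep (p (y \<ominus> x)) \<omega>)"
proof -
  have "openin (Tc P E \<P>) (carrier E - M)"
    using closed by (simp add: closedin_def topspace_Tc)
  then obtain \<Q> \<epsilon> where Q: "\<Q> \<subseteq> \<P>" "finite \<Q>" "\<Q> \<noteq> {}" and \<epsilon>: "\<epsilon> \<in> L0_pos P"
    and sub: "Tc_nbhd P E \<Q> \<epsilon> x \<subseteq> carrier E - M"
    unfolding openin_Tc_iff using x by (meson DiffI)
  have \<epsilon>': "\<epsilon> \<in> L0 P UNIV" "AE \<omega> in P. 0 < rep \<epsilon> \<omega>" using \<epsilon> by (auto simp: L0_pos_def)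
  have [measurable]: "rep \<epsilon> \<in> borel_measurable P" using rep_rv[OF \<epsilon>'(1)] by simp
  have meas: "rep (p (y \<ominus> x)) \<in> borel_measurable P" if "p \<in> \<Q>" "y \<in> M" for p y
    using that Q M x by (intro seminorm_measurable) auto
  define A where "A = (\<lambda>y. {\<omega> \<in> space P. \<forall>p\<in>\<Q>. rep (p (y \<ominus> x)) \<omega> \<le> rep \<epsilon> \<omega>})"
  have A: "A y \<in> sets P" if y: "y \<in> M" for y
  proof -
    have "{\<omega> \<in> space P. rep (p (y \<ominus> x)) \<omega> \<le> rep \<epsilon> \<omega>} \<in> sets P" if "p \<in> \<Q>" for p
      using meas[OF that y] by measurable
    then show ?thesis unfolding A_def using Q by (intro sets.sets_Collect_finite_All) auto
  qed
  then have "A ` M \<subseteq> sets P" by auto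
  then obtain \<B> where \<B>: "\<B> \<subseteq> A ` M" "countable \<B>"
    and ess: "\<And>C. C \<in> A ` M \<Longrightarrow> AE \<omega> in P. \<omega> \<in> C \<longrightarrow> \<omega> \<in> \<Union>\<B>"
    by (rule countable_essential_union) blast
  define B where "B = space P - \<Union>\<B>"
  have BP: "B \<in> sets P" unfolding B_def using \<B> A by (intro sets.Diff sets.countable_Union) auto
  have "measure P B > 0"
  proof (rule ccontr)
    assume "\<not> measure P B > 0"
    then have B0: "measure P B = 0" using measure_nonneg[of P B] by linarith
    then have nullB: "AE \<omega> in P. \<omega> \<notin> B"
      using BP by (intro AE_not_in) (auto simp: null_sets_def emeasure_eq_measure)
    \<comment> \<open>An empty family would make \<open>B\<close> the whole space, of probability
      one. Nonemptiness lets the family be enumerated as a sequence, possibly with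
      repetitions.\<close>
    have "\<B> \<noteq> {}" using B0 prob_space by (auto simp: B_def)
    define D where "D = from_nat_into \<B>"
    have D: "\<B> = range D" unfolding D_def
      using range_from_nat_into[OF \<open>\<B> \<noteq> {}\<close> \<B>(2)] by simp
    have "\<exists>y. y \<in> M \<and> D n = A y" for n using \<B>(1) D by blast
    then obtain u where u: "\<And>n. u n \<in> M" "\<And>n. D n = A (u n)" by metis
    \<comment> \<open>Concatenation asks for an exact partition, so the null set \<open>B\<close> is
      thrown in to cover the space before the sets are made disjoint.\<close>
    define G where "G = disjointed (\<lambda>n. D n \<union> B)"
    have G: "range G \<subseteq> sets P" unfolding G_def
      using A u BP by (intro sets.range_disjointed_sets) auto
    have space: "(\<Union>n. G n) = space P"
      unfolding G_def UN_disjointed_eq using u A[THEN sets.sets_into_space] D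
      by (auto simp: B_def A_def)
    have disj: "disjoint_family G" unfolding G_def by (rule disjoint_family_disjointed)
    have "range u \<subseteq> M" using u(1) by blast
    with conc[unfolded countable_concatenation_def, THEN spec, THEN spec, of u G] G disj space
    have "\<exists>y\<in>M. \<forall>n. scal (indicator (G n)) y = scal (indicator (G n)) (u n)"
      unfolding L0_indicator_smult by simp
    then obtain y where y: "y \<in> M"
      and yu: "\<And>n. scal (indicator (G n)) y = scal (indicator (G n)) (u n)"
      by blast
    have yE: "y \<in> carrier E" using y M by blast
    have "AE \<omega> in P. rep (p (y \<ominus> x)) \<omega> \<le> rep \<epsilon> \<omega>" if p: "p \<in> \<Q>" for p
    proof -
      have "AE \<omega> in P. \<omega> \<in> G n \<longrightarrow> rep (p (y \<ominus> x)) \<omega> \<le> rep \<epsilon> \<omega>" for n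
      proof -
        have pP: "p \<in> \<P>" and uE: "u n \<in> carrier E" using p Q(1) u(1)[of n] M(1) by auto
        have i: "(indicator (G n) :: 'w \<Rightarrow> real) \<in> borel_measurable P"
          using G by (intro borel_measurable_indicator) auto
        \<comment> \<open>On \<open>G n\<close> the glued element agrees with \<open>u n\<close>, so
          by homogeneity every seminorm of their differences with \<open>x\<close> agrees there
          too.\<close>
        have eq: "scal (indicator (G n)) (y \<ominus> x) = scal (indicator (G n)) (u n \<ominus> x)"
          using yu[of n] i yE uE x by (simp add: M.minus_eq scal_add_right)
        show ?thesis
          using seminorm_scal[OF pP i M.minus_closed[OF yE x(1)], unfolded eq]
            seminorm_scal[OF pP i M.minus_closed[OF uE x(1)]] nullB
        proof eventually_elim
          case (elim \<omega>)
          show ?case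
          proof
            assume w: "\<omega> \<in> G n"
            then have "\<omega> \<in> D n" using elim(3) disjointed_subset[of "\<lambda>n. D n \<union> B" n] by (auto simp: G_def)
            then have "rep (p (u n \<ominus> x)) \<omega> \<le> rep \<epsilon> \<omega>" using p by (auto simp: u(2) A_def)
            then show "rep (p (y \<ominus> x)) \<omega> \<le> rep \<epsilon> \<omega>" using elim(1,2) w by simp
          qed
        qed
      qed
      then have "AE \<omega> in P. \<forall>n. \<omega> \<in> G n \<longrightarrow> rep (p (y \<ominus> x)) \<omega> \<le> rep \<epsilon> \<omega>"
        by (subst AE_all_countable) blast
      with AE_space show ?thesis
        by eventually_elim (use space in blast)
    qed
    then have "y \<in> Tc_nbhd P E \<Q> \<epsilon> x" using Tc_nbhd_iff[OF Q(1) \<epsilon> x(1)] yE by blast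
    then show False using sub y by blast
  qed
  \<comment> \<open>At a point outside \<open>A y\<close> some seminorm exceeds \<epsilon>, but
    which one depends on the point and on \<open>y\<close>. The sum dominates all of them, which
    makes one estimate serve everywhere.\<close>
  moreover have "AE \<omega> in P. \<omega> \<in> B \<longrightarrow> rep \<epsilon> \<omega> \<le> (\<Sum>p\<in>\<Q>. rep (p (y \<ominus> x)) \<omega>)" if y: "y \<in> M" for y
  proof -
    have "AE \<omega> in P. \<forall>p\<in>\<Q>. 0 \<le> rep (p (y \<ominus> x)) \<omega>"
      using Q y M x by (intro AE_finite_allI seminorm_nonneg) auto
    moreover have "AE \<omega> in P. \<omega> \<in> A y \<longrightarrow> \<omega> \<in> \<Union>\<B>" using y by (intro ess) blast
    ultimately show ?thesis using AE_space
    proof eventually_elim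
      case (elim \<omega>)
      show ?case
      proof
        assume "\<omega> \<in> B"
        then have "\<omega> \<notin> A y" using elim by (auto simp: B_def)
        then obtain p where p: "p \<in> \<Q>" "rep \<epsilon> \<omega> < rep (p (y \<ominus> x)) \<omega>"
          using elim(3) by (auto simp: A_def not_le)
        have "rep (p (y \<ominus> x)) \<omega> \<le> (\<Sum>p\<in>\<Q>. rep (p (y \<ominus> x)) \<omega>)"
          using elim(1) Q p by (intro member_le_sum) auto
        then show "rep \<epsilon> \<omega> \<le> (\<Sum>p\<in>\<Q>. rep (p (y \<ominus> x)) \<omega>)" using p by linarith
      qed
    qed
  qed
  ultimately show thesis using that[OF Q _ \<epsilon>'(2) BP] by simp
qed

lemma L0_sublinear_indicator_sum:
  assumes Q: "\<Q> \<subseteq> \<P>" "finite \<Q>" and B: "B \<in> sets P"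
  shows "L0_sublinear P K E \<P> (\<lambda>e \<omega>. indicator B \<omega> * (\<Sum>p\<in>\<Q>. rep (p e) \<omega>))"
proof
  have pP: "p \<in> \<P>" if "p \<in> \<Q>" for p using that Q by blast
  fix e assume e: "e \<in> carrier E"
  have [measurable]: "(\<lambda>\<omega>. \<Sum>p\<in>\<Q>. rep (p e) \<omega>) \<in> borel_measurable P"
    using pP e seminorm_measurable by (intro borel_measurable_sum) auto
  show "(\<lambda>\<omega>. indicator B \<omega> * (\<Sum>p\<in>\<Q>. rep (p e) \<omega>)) \<in> borel_measurable P"
    using B by measurable
  show "AE \<omega> in P. indicator B \<omega> * (\<Sum>p\<in>\<Q>. rep (p (scal t e)) \<omega>) =
      \<bar>t \<omega>\<bar> * (indicator B \<omega> * (\<Sum>p\<in>\<Q>. rep (p e) \<omega>))" if t: "t \<in> borel_measurable P" for t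
  proof -
    have "AE \<omega> in P. \<forall>p\<in>\<Q>. rep (p (scal t e)) \<omega> = \<bar>t \<omega>\<bar> * rep (p e) \<omega>"
      using Q(2) pP by (intro AE_finite_allI seminorm_scal t e) auto
    then show ?thesis by eventually_elim (simp add: sum_distrib_left mult.left_commute)
  qed
  show "AE \<omega> in P. indicator B \<omega> * (\<Sum>p\<in>\<Q>. rep (p (e \<oplus> e')) \<omega>) \<le>
      indicator B \<omega> * (\<Sum>p\<in>\<Q>. rep (p e) \<omega>) + indicator B \<omega> * (\<Sum>p\<in>\<Q>. rep (p e') \<omega>)"
    if e': "e' \<in> carrier E" for e'
  proof -
    have "AE \<omega> in P. \<forall>p\<in>\<Q>. rep (p (e \<oplus> e')) \<omega> \<le> rep (p e) \<omega> + rep (p e') \<omega>"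
      using Q(2) pP by (intro AE_finite_allI seminorm_triangle e e') auto
    then show ?thesis
    proof eventually_elim
      case (elim \<omega>)
      have "(\<Sum>p\<in>\<Q>. rep (p (e \<oplus> e')) \<omega>) \<le> (\<Sum>p\<in>\<Q>. rep (p e) \<omega>) + (\<Sum>p\<in>\<Q>. rep (p e') \<omega>)"
        unfolding sum.distrib[symmetric] using elim by (intro sum_mono) auto
      then show ?case by (auto simp: indicator_def)
    qed
  qed
qed

end

theorem corollary4p8:
  fixes P :: "'w measure"
    and K :: "complex set"
    and E :: "(('w \<Rightarrow> complex) set, 'e, 'm) module_scheme"
    and \<P> :: "('e \<Rightarrow> ('w \<Rightarrow> real) set) set"
    and M :: "'e set"
    and x :: 'e
  assumes "random_locally_convex_module P K E \<P>"
    and "x \<in> carrier E"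
    and "M \<subseteq> carrier E" and "M \<noteq> {}"
    and "closedin (Tc P E \<P>) M"
    and "L0_convex P K E M"
    and "countable_concatenation P K E M"
    and "x \<notin> M"
  shows "\<exists>f\<in>dual_c P K E \<P>. \<exists>B\<in>sets P. measure P B > 0 \<and>
    less_on P B (sup_Re P f M) (L0_ext P (L0_Re P (f x))) \<and>
    eq_on P (space P - B) (L0_ext P (L0_Re P (f x))) (sup_Re P f M)"
proof -
  interpret random_locally_convex_module P K E \<P> by fact
  note x = \<open>x \<in> carrier E\<close> and M = \<open>M \<subseteq> carrier E\<close> \<open>M \<noteq> {}\<close>
  obtain \<Q> \<epsilon> B where Q: "\<Q> \<subseteq> \<P>" "finite \<Q>" "\<Q> \<noteq> {}"
    and \<epsilon> [measurable]: "\<epsilon> \<in> borel_measurable P" and \<epsilon>pos: "AE \<omega> in P. 0 < \<epsilon> \<omega>"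
    and B [measurable]: "B \<in> sets P" and PB: "measure P B > 0"
    and gap: "\<And>y. y \<in> M \<Longrightarrow> AE \<omega> in P. \<omega> \<in> B \<longrightarrow> \<epsilon> \<omega> \<le> (\<Sum>p\<in>\<Q>. rep (p (y \<ominus>\<^bsub>E\<^esub> x)) \<omega>)"
    using closed_concatenation_gap[OF M assms(5,7) x assms(8)] by blast
  let ?N = "\<lambda>e \<omega>. indicator B \<omega> * (\<Sum>p\<in>\<Q>. rep (p e) \<omega>)"
  interpret N: L0_sublinear P K E \<P> ?N by (rule L0_sublinear_indicator_sum[OF Q(1,2) B])
  let ?h = "\<lambda>\<omega>. indicator B \<omega> * \<epsilon> \<omega>"
  let ?D = "(\<lambda>y. x \<ominus>\<^bsub>E\<^esub> y) ` M"
  have D: "?D \<subseteq> carrier E" "?D \<noteq> {}" using M x by auto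
  have convex: "scal l d \<oplus>\<^bsub>E\<^esub> scal (\<lambda>\<omega>. 1 - l \<omega>) d' \<in> ?D"
    if d: "d \<in> ?D" "d' \<in> ?D" and l: "l \<in> borel_measurable P" "\<And>\<omega>. 0 \<le> l \<omega> \<and> l \<omega> \<le> 1" for d d' l
  proof -
    obtain y y' where y: "y \<in> M" "d = x \<ominus>\<^bsub>E\<^esub> y" and y': "y' \<in> M" "d' = x \<ominus>\<^bsub>E\<^esub> y'" using d by blast
    have E: "y \<in> carrier E" "y' \<in> carrier E" using y y' M by auto
    have m: "(\<lambda>\<omega>. 1 - l \<omega>) \<in> borel_measurable P" using l by measurable
    have "scal (\<lambda>\<omega>. l \<omega> + (1 - l \<omega>)) x = scal l x \<oplus>\<^bsub>E\<^esub> scal (\<lambda>\<omega>. 1 - l \<omega>) x"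
      using l(1) m x by (rule scal_add_left)
    then have xx: "scal l x \<oplus>\<^bsub>E\<^esub> scal (\<lambda>\<omega>. 1 - l \<omega>) x = x" using x by (simp add: scal_one)
    have "scal l d \<oplus>\<^bsub>E\<^esub> scal (\<lambda>\<omega>. 1 - l \<omega>) d' =
        (scal l x \<oplus>\<^bsub>E\<^esub> scal (\<lambda>\<omega>. 1 - l \<omega>) x) \<ominus>\<^bsub>E\<^esub> (scal l y \<oplus>\<^bsub>E\<^esub> scal (\<lambda>\<omega>. 1 - l \<omega>) y')"
      using E x l(1) m by (simp add: y y' M.minus_eq scal_add_right scal_minus_right M.minus_add M.a_ac)
    then show ?thesis unfolding xx using L0_convex_scal[OF assms(6) y(1) y'(1) l] by blast
  qed
  have h: "?h \<in> borel_measurable P" by measurable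
  have le: "AE \<omega> in P. ?h \<omega> \<le> ?N d \<omega>" if d: "d \<in> ?D" for d
  proof -
    obtain y where y: "y \<in> M" "d = x \<ominus>\<^bsub>E\<^esub> y" using d by blast
    have E: "y \<in> carrier E" using y M by auto
    have "d = \<ominus>\<^bsub>E\<^esub> (y \<ominus>\<^bsub>E\<^esub> x)" using E x by (simp add: y M.minus_eq M.minus_add M.a_comm)
    then have "AE \<omega> in P. ?N d \<omega> = ?N (y \<ominus>\<^bsub>E\<^esub> x) \<omega>" using N.N_minus[OF M.minus_closed[OF E x]] by simp
    then show ?thesis using gap[OF y(1)]
    proof eventually_elim
      case (elim \<omega>)
      then show ?case by (cases "\<omega> \<in> B") auto
    qed
  qed
  obtain F where F:
    "\<And>e. e \<in> carrier E \<Longrightarrow> F e \<in> borel_measurable P"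
    "\<And>e e'. e \<in> carrier E \<Longrightarrow> e' \<in> carrier E \<Longrightarrow> AE \<omega> in P. F (e \<oplus>\<^bsub>E\<^esub> e') \<omega> = F e \<omega> + F e' \<omega>"
    "\<And>t e. t \<in> borel_measurable P \<Longrightarrow> e \<in> carrier E \<Longrightarrow> AE \<omega> in P. F (scal t e) \<omega> = t \<omega> * F e \<omega>"
    and FN: "\<And>e. e \<in> carrier E \<Longrightarrow> AE \<omega> in P. \<bar>F e \<omega>\<bar> \<le> ?N e \<omega>"
    and FD: "\<And>d. d \<in> ?D \<Longrightarrow> AE \<omega> in P. ?h \<omega> \<le> F d \<omega>"
    using N.convex_separation[OF D convex h le] by blast
  \<comment> \<open>Continuity is tested against plain sums of seminorms in \<open>\<P>\<close>, so
    the indicator is dropped here; it returns through \<open>FN\<close> off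
    \<open>B\<close>.\<close>
  have bound: "AE \<omega> in P. \<bar>F e \<omega>\<bar> \<le> (\<Sum>p\<in>\<Q>. rep (p e) \<omega>)" if e: "e \<in> carrier E" for e
  proof -
    have "AE \<omega> in P. \<forall>p\<in>\<Q>. 0 \<le> rep (p e) \<omega>"
      using Q e by (intro AE_finite_allI seminorm_nonneg) auto
    then show ?thesis using FN[OF e]
    proof eventually_elim
      case (elim \<omega>)
      then show ?case by (cases "\<omega> \<in> B") (auto simp: sum_nonneg)
    qed
  qed
  obtain f where f: "f \<in> dual_c P K E \<P>"
    and Re_f: "\<And>e. e \<in> carrier E \<Longrightarrow> AE \<omega> in P. Re (rep (f e) \<omega>) = F e \<omega>"
    using real_functional_is_Re[OF F bound Q] by blast
  have fL: "f e \<in> L0 P K" if "e \<in> carrier E" for e using f that by (auto simp: dual_c_def)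
  have rf: "AE \<omega> in P. rep (L0_ext P (L0_Re P (f e))) \<omega> = ereal (F e \<omega>)" if e: "e \<in> carrier E" for e
    using rep_L0_ext[OF L0_Re_closed[OF fL[OF e]]] rep_L0_Re[OF fL[OF e]] Re_f[OF e]
    by eventually_elim simp
  have diff: "AE \<omega> in P. F y \<omega> \<le> F x \<omega> - ?h \<omega>" if y: "y \<in> M" for y
  proof -
    have E: "y \<in> carrier E" "x \<ominus>\<^bsub>E\<^esub> y \<in> carrier E" using y M x by auto
    have "(x \<ominus>\<^bsub>E\<^esub> y) \<oplus>\<^bsub>E\<^esub> y = x" using E x by (simp add: M.minus_eq M.a_assoc M.l_neg)
    then have "AE \<omega> in P. F x \<omega> = F (x \<ominus>\<^bsub>E\<^esub> y) \<omega> + F y \<omega>" using F(2)[OF E(2,1)] by simp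
    moreover have "AE \<omega> in P. ?h \<omega> \<le> F (x \<ominus>\<^bsub>E\<^esub> y) \<omega>" using y by (intro FD) blast
    ultimately show ?thesis by eventually_elim simp
  qed
  let ?S = "(\<lambda>y. L0_ext P (L0_Re P (f y))) ` M"
  \<comment> \<open>An upper bound common to all \<open>y\<close>. Strict inequalities for the
    single \<open>y\<close> might be lost in the supremum; the gap \<epsilon>, independent of
    \<open>y\<close>, is not.\<close>
  let ?u = "L0_class P UNIV (\<lambda>\<omega>. ereal (F x \<omega> - ?h \<omega>))"
  have S: "?S \<subseteq> L0 P UNIV" using M fL by (auto intro!: L0_ext_closed L0_Re_closed)
  have urv: "(\<lambda>\<omega>. ereal (F x \<omega> - ?h \<omega>)) \<in> rv P UNIV" using F(1)[OF x] h by simp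
  note ru = rep_class[OF urv]
  have "L0_le P (L0_ext P (L0_Re P (f y))) ?u" if y: "y \<in> M" for y
  proof -
    have "y \<in> carrier E" using y M by blast
    from rf[OF this] diff[OF y] ru show ?thesis unfolding L0_le_def by eventually_elim simp
  qed
  then have "L0_le P (sup_Re P f M) ?u"
    unfolding sup_Re_def using L0_bar_Sup_le_iff[OF prob_space_axioms S L0_class_in[OF urv]] by blast
  then have upper: "AE \<omega> in P. rep (sup_Re P f M) \<omega> \<le> ereal (F x \<omega> - ?h \<omega>)"
    unfolding L0_le_def using ru by eventually_elim simp
  \<comment> \<open>From below a single element of \<open>M\<close> suffices: off \<open>B\<close>
    its value \<open>F y\<close> is zero, just like \<open>F x\<close>, and this pins down the
    supremum there.\<close>
  obtain y where y: "y \<in> M" using M by blast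
  then have yE: "y \<in> carrier E" using M by blast
  have "L0_le P (sup_Re P f M) (sup_Re P f M)" by (simp add: L0_le_def)
  then have "L0_le P (L0_ext P (L0_Re P (f y))) (sup_Re P f M)"
    unfolding sup_Re_def
    using L0_bar_Sup_le_iff[OF prob_space_axioms S L0_bar_Sup_closed[OF prob_space_axioms S]] y by blast
  then have lower: "AE \<omega> in P. ereal (F y \<omega>) \<le> rep (sup_Re P f M) \<omega>"
    unfolding L0_le_def using rf[OF yE] by eventually_elim simp
  have "less_on P B (sup_Re P f M) (L0_ext P (L0_Re P (f x)))"
    unfolding less_on_def using upper \<epsilon>pos rf[OF x]
  proof eventually_elim
    case (elim \<omega>)
    show ?case
    proof
      assume "\<omega> \<in> B"
      then have "ereal (F x \<omega> - ?h \<omega>) < ereal (F x \<omega>)" using elim by simp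
      then show "rep (sup_Re P f M) \<omega> < rep (L0_ext P (L0_Re P (f x))) \<omega>"
        unfolding elim(3) by (rule le_less_trans[OF elim(1)])
    qed
  qed
  moreover have "eq_on P (space P - B) (L0_ext P (L0_Re P (f x))) (sup_Re P f M)"
    unfolding eq_on_def using upper lower rf[OF x] FN[OF x] FN[OF yE]
  proof eventually_elim
    case (elim \<omega>)
    show ?case
    proof
      assume "\<omega> \<in> space P - B"
      then have zero: "F x \<omega> = 0" "F y \<omega> = 0" "?h \<omega> = 0" using elim by auto
      have "rep (sup_Re P f M) \<omega> \<le> ereal (F x \<omega>)" "ereal (F x \<omega>) \<le> rep (sup_Re P f M) \<omega>"
        using elim(1,2) by (simp_all only: zero diff_zero)
      then show "rep (L0_ext P (L0_Re P (f x))) \<omega> = rep (sup_Re P f M) \<omega>"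
        unfolding elim(3) by (rule order_antisym[rotated])
    qed
  qed
  ultimately show ?thesis using f B PB by blast
qed

end
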